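(* Let $\{\lambda_n\}_{n\ge1}$ be an admissible scale and let $\nu>-1$ be real. For $v\in\mathbb{R}$ and each $n$ put $z=e^{2\pi v}$ and $q=e^{-\pi\lambda_n^{-1}}$. Then $$J_\nu^{(2)}(2i\sqrt{zq^{-\nu}}\,q^{-2n};q)=\frac{\exp\left(\frac{\pi\lambda_n}{3}-\frac{\pi}{12\lambda_n}+\frac{\nu^2\pi}{4\lambda_n}+\frac{\nu\pi i}{2}\right)}{2\sqrt{\lambda_n}}\exp\left\{\pi\lambda_n\left(v+\frac{4n+\nu}{2\lambda_n}\right)^2\right\}\left\{1+\mathcal{O}(e^{-\pi\lambda_n})\right\}$$ and $$J_\nu^{(2)}(2\sqrt{zq^{-\nu}}\,q^{-2n};q)=\frac{\exp\left(\frac{\pi\lambda_n}{12}-\frac{\pi}{12\lambda_n}+\frac{\nu^2\pi}{4\lambda_n}\right)}{\sqrt{\lambda_n}}\exp\left\{\pi\lambda_n\left(v+\frac{4n+\nu}{2\lambda_n}\right)^2\right\}\left\{\cos\pi\lambda_nv+\mathcal{O}\left(e^{-2\pi\lambda_n}\right)\right\}$$ as $n\to\infty$, where the $\mathcal{O}$-terms are uniform for $v$ in any compact subset of $\mathbb{R}$.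
   Context: An admissible scale is a sequence $\{\lambda_n\}_{n=1}^\infty$ of positive numbers with $\lim_{n\to\infty}\lambda_n/\log n=\infty$ and $\lim_{n\to\infty}n/\lambda_n^2=\infty$. For $0<q<1$, $(x;q)_\infty=\prod_{k=0}^\infty(1-xq^k)$, $(x;q)_k=(x;q)_\infty/(xq^k;q)_\infty$, and $(x,y;q)_k=(x;q)_k(y;q)_k$. Jackson's $q$-Bessel function is, for $\nu>-1$, $$J_\nu^{(2)}(w;q)=\frac{(q^{\nu+1};q)_\infty}{(q;q)_\infty}\sum_{k=0}^\infty\frac{q^{k^2+k\nu}(-1)^k}{(q,q^{\nu+1};q)_k}\left(\frac w2\right)^{2k+\nu},$$ with the principal branch of $(w/2)^\nu$ (so $i^\nu=e^{\nu\pi i/2}$); $\sqrt{zq^{-\nu}}$ is the positive square root. Note that $q$ depends on $n$. Uniformity on compacts means: for each compact $K\subset\mathbb{R}$ there are $C,N$ such that the error term is bounded in absolute value by $C$ times the indicated quantity for all $n\ge N$ and $v\in K$. *)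

theory Defs
  imports "HOL-Complex_Analysis.Complex_Analysis"
begin

text \<open>The values at \<open>n = 0\<close> and the division by \<open>ln 1 = 0\<close> at \<open>n = 1\<close> play no role in the limits;
  positivity is required for \<open>n \<ge> 1\<close> only.\<close>

definition admissible_scale :: "(nat \<Rightarrow> real) \<Rightarrow> bool" where
  "admissible_scale lam \<longleftrightarrow>
     (\<forall>n\<ge>1. lam n > 0) \<and>
     filterlim (\<lambda>n. lam n / ln (real n)) at_top sequentially \<and>
     filterlim (\<lambda>n. real n / (lam n)\<^sup>2) at_top sequentially"

definition qpoch_inf :: "'a::real_normed_field \<Rightarrow> 'a \<Rightarrow> 'a" where
  "qpoch_inf x q = (\<Prod>k. 1 - x * q ^ k)"

definition qpoch :: "'a::real_normed_field \<Rightarrow> 'a \<Rightarrow> nat \<Rightarrow> 'a" where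
  "qpoch x q k = qpoch_inf x q / qpoch_inf (x * q ^ k) q"

text \<open>Jackson's second \<open>q\<close>-Bessel function, for \<open>0 < q < 1\<close>, \<open>\<nu> > -1\<close> and \<open>w \<noteq> 0\<close>. The power
  \<open>(w/2)\<^sup>2\<^sup>k\<^sup>+\<^sup>\<nu>\<close> is split as \<open>(w/2)\<^sup>2\<^sup>k (w/2)\<^sup>\<nu>\<close>; complex \<open>powr\<close> is the principal branch.
  At \<open>w = 0\<close> the convention \<open>0 powr a = 0\<close> makes the definition differ from the usual one
  when \<open>\<nu> = 0\<close>.\<close>

definition jackson_J2 :: "real \<Rightarrow> complex \<Rightarrow> real \<Rightarrow> complex" where
  "jackson_J2 \<nu> w q =
     of_real (qpoch_inf (q powr (\<nu> + 1)) q / qpoch_inf q q) *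
     (\<Sum>k. of_real (q powr ((real k)\<^sup>2 + real k * \<nu>) * (-1) ^ k /
               (qpoch q q k * qpoch (q powr (\<nu> + 1)) q k)) *
           ((w / 2) ^ (2 * k) * (w / 2) powr of_real \<nu>))"

text \<open>\<open>E n v = O(g n)\<close> as \<open>n \<rightarrow> \<infinity>\<close>, uniformly for \<open>v\<close> in compact subsets of the real line.\<close>

definition bigo_unif_compact :: "(nat \<Rightarrow> real \<Rightarrow> complex) \<Rightarrow> (nat \<Rightarrow> real) \<Rightarrow> bool" where
  "bigo_unif_compact E g \<longleftrightarrow>
     (\<forall>K. compact K \<longrightarrow> (\<exists>C N. \<forall>n\<ge>N. \<forall>v\<in>K. norm (E n v) \<le> C * g n))"

end

theory Submission
  imports Defs "HOL-Probability.Characteristic_Functions"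
begin

text \<open>
  Completing the square around the index \<open>k = 2 * n\<close> turns the defining series of the \<open>q\<close>-Bessel function
  into \<open>(q; q)\<^sub>\<infinity>\<close> to the power \<open>-2\<close> times a theta series in \<open>q\<close>, cut off at \<open>j = -2 * n\<close> and
  weighted by \<open>q\<close>-factorials; since \<open>n\<close> is much larger than the square of \<open>\<lambda>\<^sub>n\<close>, cut-off and weights cost only
  \<open>O(exp (- 5 * pi * \<lambda>\<^sub>n))\<close> relative to the central Gaussian. Poisson summation converts the theta series into a rapidly convergent sum of
  Gaussians in which the terms nearest to the origin dominate: one Gaussian for the argument \<open>\<i>\<close>, and
  a conjugate pair, producing the cosine, for the alternating series. The factor \<open>(q; q)\<^sub>\<infinity>\<close> is treated
  the same way, being itself a theta series by the pentagonal number theorem.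
\<close>

subsection \<open>The pentagonal number theorem\<close>

text \<open>The sign \<open>(-1)^j\<close> is absorbed into the argument: an alternating theta term
  at \<open>v\<close> is the plain theta term at \<open>v + \<i> / 2\<close>. One transformation
  formula thus serves both Bessel arguments and the pentagonal series. The shift moves the Gaussians
  on the other side from integers to half-integers, which is why they come in pairs there. The
  obstacle is loss of size. In the cosine case the main term is smaller than the central Gaussian by
  \<open>exp (- pi * l / 4)\<close>, and the cosine may vanish, so errors are measured against the
  amplitude in front of it. The first discarded Gaussians fix the rates: \<open>1 - 0 = 1\<close>
  for the first expansion, \<open>9/4 - 1/4 = 2\<close> for the second. All other errors must stay
  below these: cut-off and weights have rate 5, at least 4.75 after division by the amplitude, and
  the Euler product has rate 4. Poisson summation comes from Fourier inversion for a function
  holomorphic on a disc, applied to a sum of shifted Gaussians; its Fourier coefficients are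
  Gaussian integrals, known from the characteristic function of the normal distribution.\<close>

lemma convergent_prod_qpoch:
  fixes x q :: real
  assumes "\<bar>q\<bar> < 1"
  shows "convergent_prod (\<lambda>k. 1 - x * q ^ k)"
proof -
  have "summable (\<lambda>k. norm ((1 - x * q ^ k) - 1))"
    using assms by (simp add: abs_mult power_abs summable_mult)
  thus ?thesis
    by (intro abs_convergent_prod_imp_convergent_prod summable_imp_abs_convergent_prod)
qed

lemma qpoch_inf_LIMSEQ:
  fixes x q :: real
  assumes "\<bar>q\<bar> < 1"
  shows "(\<lambda>n. \<Prod>k<n. 1 - x * q ^ k) \<longlonglongrightarrow> qpoch_inf x q"
proof -
  have "(\<lambda>n. \<Prod>k\<le>n. 1 - x * q ^ k) \<longlonglongrightarrow> qpoch_inf x q"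
    unfolding qpoch_inf_def by (rule convergent_prod_LIMSEQ [OF convergent_prod_qpoch [OF assms]])
  hence "(\<lambda>n. \<Prod>k<Suc n. 1 - x * q ^ k) \<longlonglongrightarrow> qpoch_inf x q"
    by (simp add: lessThan_Suc_atMost)
  thus ?thesis by (rule LIMSEQ_imp_Suc)
qed

lemma qpoch_inf_pos:
  fixes x q :: real
  assumes "0 < q" "q < 1" "0 \<le> x" "x < 1"
  shows "qpoch_inf x q > 0"
proof -
  have less: "x * q ^ k < 1" for k
    using assms mult_le_one [of "q ^ k" x] power_le_one [of q k]
    by (metis less_eq_real_def mult.commute mult_left_le order_le_less_trans)
  have "qpoch_inf x q \<noteq> 0"
    unfolding qpoch_inf_def
    by (rule prodinf_nonzero [OF convergent_prod_qpoch]) (use assms less in \<open>auto simp: less_le\<close>)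
  moreover have "qpoch_inf x q \<ge> 0"
    by (rule LIMSEQ_le_const [OF qpoch_inf_LIMSEQ])
       (use assms less in \<open>auto intro!: prod_nonneg exI[of _ 0] simp: less_imp_le\<close>)
  ultimately show ?thesis by simp
qed

text \<open>Weierstrass' product inequality. The three bounds share one induction because the step
  for the lower bound needs \<open>0 \<le> ?P\<close> and \<open>?P \<le> 1\<close>.\<close>

lemma prod_one_minus_ge:
  fixes f :: "nat \<Rightarrow> real"
  assumes "\<And>k. 0 \<le> f k" "\<And>k. f k \<le> 1"
  shows "1 - (\<Sum>k<n. f k) \<le> (\<Prod>k<n. 1 - f k) \<and> (\<Prod>k<n. 1 - f k) \<le> 1 \<and> 0 \<le> (\<Prod>k<n. 1 - f k)"
proof (induction n)
  case (Suc n)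
  let ?P = "\<Prod>k<n. 1 - f k"
  have "?P * f n \<le> f n" "0 \<le> ?P * f n" "?P * f n \<le> ?P"
    using Suc assms by (auto intro!: mult_left_le_one_le mult_left_le)
  moreover have "(\<Prod>k<Suc n. 1 - f k) = ?P - ?P * f n" "(\<Sum>k<Suc n. f k) = (\<Sum>k<n. f k) + f n"
    by (simp_all add: algebra_simps)
  ultimately show ?case using Suc by linarith
qed auto

lemma qpoch_inf_bounds:
  fixes x q :: real
  assumes "0 < q" "q < 1" "0 \<le> x" "x \<le> 1"
  shows "1 - x / (1 - q) \<le> qpoch_inf x q" "qpoch_inf x q \<le> 1" "0 \<le> qpoch_inf x q"
proof -
  have *: "0 \<le> x * q ^ k" "x * q ^ k \<le> 1" for k
    using assms by (auto intro!: mult_le_one power_le_one)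
  note b = prod_one_minus_ge [of "\<lambda>k. x * q ^ k", OF *]
  have lim: "(\<lambda>n. 1 - (\<Sum>k<n. x * q ^ k)) \<longlonglongrightarrow> 1 - x / (1 - q)"
    using sums_mult [OF geometric_sums [of q], of x] assms
    by (intro tendsto_diff) (auto simp: sums_def)
  show "1 - x / (1 - q) \<le> qpoch_inf x q"
    by (rule LIMSEQ_le [OF lim qpoch_inf_LIMSEQ]) (use assms b in auto)
  show "qpoch_inf x q \<le> 1"
    by (rule LIMSEQ_le_const2 [OF qpoch_inf_LIMSEQ]) (use assms b in auto)
  show "0 \<le> qpoch_inf x q"
    by (rule LIMSEQ_le_const [OF qpoch_inf_LIMSEQ]) (use assms b in auto)
qed

text \<open>Shanks' finite form of the pentagonal number theorem: from \<open>n\<close> to \<open>Suc n\<close> the summands on the left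
  change by a telescoping difference.\<close>

lemma shanks_identity:
  fixes q :: real
  shows "(\<Sum>s\<le>n. (-1) ^ s * (\<Prod>i=Suc s..n. 1 - q ^ i) * q ^ (n * s + (\<Sum>i\<le>s. i))) =
         1 + (\<Sum>k=1..n. (-1) ^ k * (q ^ (k\<^sup>2 + (\<Sum>i<k. i)) + q ^ (k\<^sup>2 + (\<Sum>i\<le>k. i))))"
proof (induction n)
  case 0
  show ?case by simp
next
  case (Suc n)
  define t where "t n s = (-1) ^ s * (\<Prod>i=Suc s..n. 1 - q ^ i) * q ^ (n * s + (\<Sum>i\<le>s. i))" for n s
  \<comment> \<open>Up to common factors, \<open>t (Suc n) s - t n s\<close> is
    \<open>- (1 - q ^ s) - q ^ (Suc n + s)\<close>. The first part is \<open>- G s\<close>; the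
    second is \<open>G (Suc s)\<close>, whose product starts one index later. The factor
    \<open>1 - q ^ 0\<close> makes \<open>G 0\<close> vanish.\<close>
  define G where "G s = (-1) ^ s * (\<Prod>i=s..n. 1 - q ^ i) * q ^ (Suc n * s + (\<Sum>i<s. i))" for s
  have step: "t (Suc n) s = t n s + (G (Suc s) - G s)" if "s \<le> n" for s
  proof -
    let ?P = "\<Prod>i=Suc s..n. 1 - q ^ i"
    have 1: "(\<Prod>i=Suc s..Suc n. 1 - q ^ i) = ?P * (1 - q ^ Suc n)"
      using that by simp
    have 2: "(\<Prod>i=s..n. 1 - q ^ i) = (1 - q ^ s) * ?P"
      using that by (rule prod.atLeast_Suc_atMost)
    have 3: "(\<Sum>i\<le>s. i) = (\<Sum>i<s. i) + s"
      by (metis lessThan_Suc_atMost sum.lessThan_Suc)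
    show ?thesis
      unfolding t_def G_def 1 2 3
      by (simp add: lessThan_Suc_atMost 3 algebra_simps power_add)
  qed
  have "(\<Sum>s\<le>Suc n. t (Suc n) s) = (\<Sum>s\<le>n. t n s) + (\<Sum>s<Suc n. G (Suc s) - G s) + t (Suc n) (Suc n)"
    by (simp add: step sum.distrib lessThan_Suc_atMost)
  also have "(\<Sum>s<Suc n. G (Suc s) - G s) = G (Suc n) - G 0"
    by (rule sum_lessThan_telescope)
  also have "G 0 = 0"
    by (simp add: G_def prod.atLeast_Suc_atMost)
  also have "G (Suc n) = (-1) ^ Suc n * q ^ ((Suc n)\<^sup>2 + (\<Sum>i<Suc n. i))"
    unfolding G_def by (simp add: power2_eq_square)
  also have "t (Suc n) (Suc n) = (-1) ^ Suc n * q ^ ((Suc n)\<^sup>2 + (\<Sum>i\<le>Suc n. i))"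
    unfolding t_def by (simp add: power2_eq_square)
  finally show ?case
    using Suc.IH unfolding t_def by (simp add: algebra_simps)
qed

text \<open>In Shanks' sum the summand \<open>s = 0\<close> is the partial product of
  \<open>qpoch_inf q q\<close>, and each of the \<open>n\<close> others is at most
  \<open>q ^ n\<close> in modulus, so they vanish in the limit. On the other side
  \<open>k\<^sup>2\<close> plus a triangular number is \<open>k (3 k + 1) / 2\<close> or
  \<open>k (3 k - 1) / 2\<close>, the exponents at \<open>j = k\<close> and
  \<open>j = - k\<close>.\<close>

lemma pentagonal_LIMSEQ:
  fixes q :: real
  assumes "0 < q" "q < 1"
  shows "(\<lambda>n. \<Sum>j\<in>{- int n..int n}. (-1) powi j * q powr (of_int j * (3 * of_int j + 1) / 2)) \<longlonglongrightarrow> qpoch_inf q q"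
proof -
  define t where "t n s = (-1) ^ s * (\<Prod>i=Suc s..n. 1 - q ^ i) * q ^ (n * s + (\<Sum>i\<le>s. i))" for n s
  define a where "a j = (-1) powi j * q powr (of_int j * (3 * of_int j + 1) / 2)" for j :: int
  have tri: "real (\<Sum>i\<le>k. i) = real k * (real k + 1) / 2" for k
    by (induction k) (auto simp: field_simps)
  have tri': "real (\<Sum>i<k. i) = real k * (real k - 1) / 2" for k
    by (induction k) (auto simp: field_simps)
  have a1: "a (int k) = (-1) ^ k * q ^ (k\<^sup>2 + (\<Sum>i\<le>k. i))" for k
    using assms by (auto simp: a_def tri powr_realpow [symmetric] field_simps power2_eq_square simp del: of_nat_sum)
  have a2: "a (- int k) = (-1) ^ k * q ^ (k\<^sup>2 + (\<Sum>i<k. i))" for k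
    using assms
    by (auto simp: a_def tri' powr_realpow [symmetric] field_simps power2_eq_square power_int_minus simp del: of_nat_sum
             simp flip: power_inverse)
  have F: "(\<Sum>j\<in>{- int n..int n}. a j) = (\<Sum>s\<le>n. t n s)" for n
  proof -
    have "(\<Sum>j\<in>{- int n..int n}. a j) = 1 + (\<Sum>k=1..n. a (- int k) + a (int k))"
    proof (induction n)
      case 0
      then show ?case using assms by (simp add: a_def)
    next
      case (Suc n)
      have "{- int (Suc n)..int (Suc n)} = insert (int (Suc n)) (insert (- int (Suc n)) {- int n..int n})"
        by auto
      then show ?case using Suc by simp
    qed
    thus ?thesis unfolding t_def shanks_identity by (simp add: a1 a2 algebra_simps)
  qed
  have lim0: "(\<lambda>n. t n 0) \<longlonglongrightarrow> qpoch_inf q q"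
  proof -
    have "t n 0 = (\<Prod>k<n. 1 - q * q ^ k)" for n
      by (simp add: t_def prod.atLeast1_atMost_eq)
    thus ?thesis using qpoch_inf_LIMSEQ [of q q] assms by simp
  qed
  have rest: "\<bar>\<Sum>s\<in>{1..n}. t n s\<bar> \<le> real n * q ^ n" for n
  proof -
    have "\<bar>t n s\<bar> \<le> q ^ n" if "s \<in> {1..n}" for s
    proof -
      have "\<bar>\<Prod>i=Suc s..n. 1 - q ^ i\<bar> \<le> 1"
        using assms by (auto simp: abs_prod power_le_one intro!: prod_le_1)
      moreover have "q ^ (n * s + (\<Sum>i\<le>s. i)) \<le> q ^ n"
        using assms that by (intro power_decreasing trans_le_add1) auto
      ultimately show ?thesis
        using assms by (auto simp: t_def abs_mult power_abs intro!: mult_mono [where c = "q ^ _" and b = 1, simplified])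
    qed
    hence "(\<Sum>s\<in>{1..n}. \<bar>t n s\<bar>) \<le> (\<Sum>s\<in>{1..n}. q ^ n)" by (intro sum_mono)
    hence "(\<Sum>s\<in>{1..n}. \<bar>t n s\<bar>) \<le> real n * q ^ n" by simp
    thus ?thesis using sum_abs [of "t n" "{1..n}"] by (rule order_trans [rotated])
  qed
  have "(\<lambda>n. real n * q ^ n) \<longlonglongrightarrow> 0"
    using powser_times_n_limit_0 [of q] assms by simp
  hence "(\<lambda>n. \<Sum>s\<in>{1..n}. t n s) \<longlonglongrightarrow> 0"
    by (rule Lim_null_comparison [rotated]) (use rest in auto)
  from tendsto_add [OF lim0 this] have "(\<lambda>n. t n 0 + (\<Sum>s\<in>{1..n}. t n s)) \<longlonglongrightarrow> qpoch_inf q q"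
    by simp
  moreover have "(\<Sum>s\<le>n. t n s) = t n 0 + (\<Sum>s\<in>{1..n}. t n s)" for n
    by (simp add: atMost_atLeast0 sum.atLeast_Suc_atMost)
  ultimately show ?thesis using F by (simp add: a_def)
qed

subsection \<open>The theta transformation\<close>

lemma has_integral_exp_period:
  fixes j :: int
  shows "((\<lambda>y. exp (of_real (- 2 * pi * of_int j * y) * \<i>)) has_integral (if j = 0 then 1 else 0)) {-1/2..1/2::real}"
proof (cases "j = 0")
  case True
  have "((\<lambda>y::real. 1::complex) has_integral (1/2 - (-1/2)) *\<^sub>R 1) {-1/2..1/2}"
    using has_integral_const_real [of "1::complex" "-1/2" "1/2"] by simp
  with True show ?thesis by simp
next
  case False
  define k where "k = - 2 * pi * of_int j * \<i>"
  have k: "k \<noteq> 0" using False by (simp add: k_def)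
  have "((\<lambda>y. exp (k * of_real y)) has_integral exp (k * of_real (1/2)) / k - exp (k * of_real (-1/2)) / k) {-1/2..1/2::real}"
    by (rule fundamental_theorem_of_calculus)
       (use k in \<open>auto intro!: derivative_eq_intros has_vector_derivative_real_field simp: field_simps\<close>)
  moreover have "exp (k * of_real (1/2)) = exp (k * of_real (-1/2))"
  proof -
    have "exp (k * of_real (1/2)) = exp (k * of_real (-1/2) + k)"
      by (simp add: algebra_simps flip: mult.assoc)
    also have "\<dots> = exp (k * of_real (-1/2)) * exp (of_int (2 * (- j)) * pi * \<i>)"
      unfolding exp_add by (simp add: k_def algebra_simps)
    also have "exp (of_int (2 * (- j)) * pi * \<i>) = 1"
      by (subst exp_eq_1) (auto intro!: exI [of _ "- j"])
    finally show ?thesis by simp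
  qed
  ultimately show ?thesis using False by (simp add: k_def algebra_simps)
qed

text \<open>Chernoff's argument: since \<open>f - f 0\<close> is divisible by \<open>exp (2 * pi * w) - 1\<close>, the Fourier
  coefficients of the difference telescope.\<close>

lemma fourier_series_holomorphic:
  fixes f :: "complex \<Rightarrow> complex" and c :: "int \<Rightarrow> complex"
  assumes f: "f holomorphic_on ball 0 1"
    and c: "\<And>j. ((\<lambda>y. f (\<i> * of_real y) * exp (of_real (- 2 * pi * of_int j * y) * \<i>)) has_integral c j) {-1/2..1/2::real}"
  shows "(\<lambda>N. \<Sum>j\<in>{- int N..int N}. c j) \<longlonglongrightarrow> f 0"
proof -
  let ?I = "{-1/2..1/2::real}"
  define e where "e j y = exp (of_real (- 2 * pi * of_int j * y) * \<i>)" for j :: int and y :: real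
  have f': "(\<lambda>w. if w = 0 then deriv f 0 else (f w - f 0) / (w - 0)) holomorphic_on ball 0 1"
    by (rule pole_lemma_open [OF f]) auto
  define B :: "complex \<Rightarrow> complex" where
    "B = (\<lambda>w::complex. if w = 0 then deriv (\<lambda>w::complex. exp (2 * pi * w)) 0 else (exp (2 * pi * w) - exp (2 * pi * (0::complex))) / (w - 0))"
  have B: "B holomorphic_on ball 0 1"
    unfolding B_def by (rule pole_lemma_open) (auto intro!: holomorphic_intros)
  have dB: "deriv (\<lambda>w::complex. exp (2 * pi * w)) 0 = 2 * pi"
    by (rule DERIV_imp_deriv) (auto intro!: derivative_eq_intros)
  \<comment> \<open>The zeros of \<open>exp (2 * pi * w) - 1\<close> are the integer multiples of
    \<open>\<i>\<close>; radius 1 leaves only the one at \<open>0\<close>, which is simple and is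
    removed by the quotient in \<open>B\<close>.\<close>
  have B0: "B w \<noteq> 0" if w: "w \<in> ball 0 1" for w
  proof (cases "w = 0")
    case False
    have "exp (2 * pi * w) \<noteq> 1"
    proof
      assume "exp (2 * pi * w) = 1"
      then obtain n :: int where n: "Re w = 0" "2 * pi * Im w = of_int (2 * n) * pi"
        unfolding exp_eq_1 by auto
      have "Im w = of_int n" using n(2) by simp
      moreover have "\<bar>Im w\<bar> < 1" using w abs_Im_le_cmod [of w] by simp
      ultimately have "n = 0" by linarith
      with n(1) \<open>Im w = of_int n\<close> False show False by (simp add: complex_eq_iff)
    qed
    with False show ?thesis by (simp add: B_def)
  qed (use dB in \<open>simp add: B_def\<close>)
  define G where "G w = (if w = 0 then deriv f 0 else (f w - f 0) / (w - 0)) / B w" for w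
  have G: "G holomorphic_on ball 0 1"
    unfolding G_def by (intro holomorphic_on_divide f' B B0)
  have fG: "f w = f 0 + (exp (2 * pi * w) - 1) * G w" if "w \<in> ball 0 1" for w :: complex
    using B0 [OF that] by (auto simp: G_def B_def divide_simps split: if_splits) (simp add: algebra_simps)
  have I: "\<i> * complex_of_real y \<in> ball 0 1" if "y \<in> ?I" for y
    using that by (auto simp: norm_mult)
  have G': "deriv G holomorphic_on ball 0 1"
    by (rule holomorphic_deriv [OF G]) auto
  have cont: "continuous_on ?I (\<lambda>y. h (\<i> * of_real y))" if "h holomorphic_on ball 0 1" for h
    by (rule continuous_on_compose2 [OF holomorphic_on_imp_continuous_on [OF that]])
       (use I in \<open>auto intro!: continuous_intros\<close>)
  define d where "d j = integral ?I (\<lambda>y. G (\<i> * of_real y) * e j y)" for j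
  have d: "((\<lambda>y. G (\<i> * of_real y) * e j y) has_integral d j) ?I" for j
    unfolding d_def e_def
    by (intro integrable_integral integrable_continuous_real continuous_intros cont G)
  \<comment> \<open>At \<open>w = \<i> * y\<close>, multiplication by
    \<open>exp (2 * pi * w)\<close> turns \<open>e j\<close> into \<open>e (j - 1)\<close>, so the
    factor \<open>exp (2 * pi * w) - 1\<close> becomes a difference of neighbouring coefficients of
    \<open>G\<close>.\<close>
  have cd: "c j = (if j = 0 then f 0 else 0) + d (j - 1) - d j" for j
  proof (rule has_integral_unique [OF c])
    have "((\<lambda>y. f 0 * e j y + G (\<i> * of_real y) * e (j - 1) y - G (\<i> * of_real y) * e j y)
            has_integral f 0 * (if j = 0 then 1 else 0) + d (j - 1) - d j) ?I"
      by (intro has_integral_diff has_integral_add has_integral_mult_right d)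
         (use has_integral_exp_period [of j] in \<open>simp add: e_def\<close>)
    also have "?this \<longleftrightarrow> ((\<lambda>y. f (\<i> * of_real y) * exp (of_real (- 2 * pi * of_int j * y) * \<i>))
                has_integral f 0 * (if j = 0 then 1 else 0) + d (j - 1) - d j) ?I"
    proof (rule has_integral_cong)
      fix y assume y: "y \<in> ?I"
      have "e (j - 1) y = exp (2 * pi * (\<i> * y)) * e j y"
        unfolding e_def exp_add [symmetric] by (simp add: algebra_simps)
      then show "f 0 * e j y + G (\<i> * of_real y) * e (j - 1) y - G (\<i> * of_real y) * e j y =
                 f (\<i> * of_real y) * exp (of_real (- 2 * pi * of_int j * y) * \<i>)"
        unfolding fG [OF I [OF y]] e_def [symmetric] by (simp add: algebra_simps)
    qed
    finally show "((\<lambda>y. f (\<i> * of_real y) * exp (of_real (- 2 * pi * of_int j * y) * \<i>))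
        has_integral (if j = 0 then f 0 else 0) + d (j - 1) - d j) ?I"
      by (auto split: if_splits)
  qed
  have sum: "(\<Sum>j\<in>{- int N..int N}. c j) = f 0 + d (- int N - 1) - d (int N)" for N
  proof (induction N)
    case (Suc N)
    have "{- int (Suc N)..int (Suc N)} = insert (int (Suc N)) (insert (- int (Suc N)) {- int N..int N})"
      by auto
    then show ?case using Suc by (simp add: cd algebra_simps) (auto intro!: arg_cong [where f = d])
  qed (simp add: cd)
  have bdd: "\<exists>M. \<forall>y\<in>?I. norm (h (\<i> * of_real y)) \<le> M" if "h holomorphic_on ball 0 1" for h
  proof -
    have "bounded ((\<lambda>y. h (\<i> * of_real y)) ` ?I)"
      by (intro compact_imp_bounded compact_continuous_image cont that compact_Icc)
    thus ?thesis unfolding bounded_iff by blast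
  qed
  obtain M where M: "\<And>y. y \<in> ?I \<Longrightarrow> norm (G (\<i> * of_real y)) \<le> M"
    using bdd [OF G] by blast
  obtain M' where M': "\<And>y. y \<in> ?I \<Longrightarrow> norm (deriv G (\<i> * of_real y)) \<le> M'"
    using bdd [OF G'] by blast
  have M0: "M \<ge> 0" "M' \<ge> 0"
    using order_trans [OF norm_ge_zero M [of 0]] order_trans [OF norm_ge_zero M' [of 0]] by auto
  \<comment> \<open>One integration by parts gives decay \<open>1 / \<bar>j\<bar>\<close>:
    \<open>P\<close> is the boundary term and \<open>Q\<close> the integrand containing
    \<open>deriv G\<close>.\<close>
  have d_bound: "norm (d j) \<le> (2 * M + M') * inverse (real_of_int \<bar>j\<bar>)" if "j \<noteq> 0" for j
  proof -
    define k where "k = - 2 * pi * of_int j * \<i>"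
    have k: "k \<noteq> 0" using that by (simp add: k_def)
    have nk: "norm k = 2 * pi * \<bar>of_int j\<bar>" by (simp add: k_def norm_mult)
    have e: "e j y = exp (k * y)" for y by (simp add: e_def k_def algebra_simps)
    have ne: "norm (e j y) = 1" for y by (simp add: e_def)
    define P where "P y = G (\<i> * of_real y) * (e j y / k)" for y
    define Q where "Q y = \<i> * deriv G (\<i> * of_real y) * (e j y / k)" for y
    have "((\<lambda>y. Q y + G (\<i> * of_real y) * e j y) has_integral P (1/2) - P (-1/2)) ?I"
    proof (rule fundamental_theorem_of_calculus)
      fix y assume y: "y \<in> ?I"
      have DG: "(G has_field_derivative deriv G (\<i> * of_real y)) (at (\<i> * of_real y))"
        by (rule holomorphic_derivI [OF G _ I [OF y]]) auto
      have DG2: "((\<lambda>w. G (\<i> * w)) has_field_derivative deriv G (\<i> * of_real y) * \<i>) (at (of_real y))"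
        by (rule DERIV_chain2 [where g = "\<lambda>w. \<i> * w"]) (use DG in \<open>auto intro!: derivative_eq_intros\<close>)
      have "((\<lambda>w. G (\<i> * w) * (exp (k * w) / k)) has_field_derivative
              \<i> * deriv G (\<i> * of_real y) * (e j y / k) + G (\<i> * of_real y) * e j y) (at (of_real y))"
        by (rule derivative_eq_intros DG2 refl | use k in \<open>simp add: e algebra_simps\<close>)+
      from has_vector_derivative_real_field [OF this]
      show "(P has_vector_derivative Q y + G (\<i> * of_real y) * e j y) (at y within ?I)"
        unfolding P_def Q_def by (simp add: e)
    qed simp
    from has_integral_diff [OF this d [of j]]
    have Q: "(Q has_integral P (1/2) - P (-1/2) - d j) ?I" by simp
    have nP: "norm (P y) \<le> M / norm k" if "y \<in> ?I" for y
      using M [OF that] k by (simp add: P_def norm_mult norm_divide ne divide_right_mono)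
    have nQ: "norm (P (1/2) - P (-1/2) - d j) \<le> M' / norm k * measure lborel (cbox (-1/2) (1/2::real))"
    proof (rule has_integral_bound)
      show "(Q has_integral P (1/2) - P (-1/2) - d j) (cbox (-1/2) (1/2))" using Q by simp
      fix y :: real assume "y \<in> cbox (-1/2) (1/2)"
      thus "norm (Q y) \<le> M' / norm k"
        using M' [of y] k by (simp add: Q_def norm_mult norm_divide ne divide_right_mono)
    qed (use M0 in auto)
    have "norm (d j) \<le> norm (P (1/2)) + norm (P (-1/2)) + norm (P (1/2) - P (-1/2) - d j)"
      by norm
    also have "\<dots> \<le> M / norm k + M / norm k + M' / norm k"
      using nP [of "1/2"] nP [of "-1/2"] nQ by (intro add_mono) auto
    also have "\<dots> = (2 * M + M') / norm k" by (simp add: add_divide_distrib)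
    also have "\<dots> \<le> (2 * M + M') / \<bar>of_int j\<bar>"
    proof (rule divide_left_mono)
      have "1 * \<bar>real_of_int j\<bar> \<le> 2 * pi * \<bar>of_int j\<bar>"
        using pi_gt3 by (intro mult_right_mono) auto
      thus "\<bar>real_of_int j\<bar> \<le> norm k" by (simp add: nk)
    qed (use M0 k that in auto)
    finally show ?thesis by (simp add: divide_inverse)
  qed
  have lim: "(\<lambda>N. (2 * M + M') * inverse (real N)) \<longlonglongrightarrow> 0"
    by (rule tendsto_eq_intros tendsto_const lim_inverse_n | simp)+
  have lim1: "(\<lambda>N. d (int N)) \<longlonglongrightarrow> 0"
    by (rule Lim_null_comparison [OF _ lim])
       (use d_bound[of "int _"] in \<open>auto simp: eventually_sequentially intro!: exI [of _ 1]\<close>)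
  have lim2: "(\<lambda>N. d (- int N - 1)) \<longlonglongrightarrow> 0"
  proof -
    have "(\<lambda>N. d (- int N)) \<longlonglongrightarrow> 0"
      by (rule Lim_null_comparison [OF _ lim])
         (use d_bound[of "- int _"] in \<open>auto simp: eventually_sequentially intro!: exI [of _ 1]\<close>)
    moreover have "- int (Suc N) = - int N - 1" for N by simp
    ultimately show ?thesis using LIMSEQ_Suc [of "\<lambda>N. d (- int N)"] by (simp only:)
  qed
  have "(\<lambda>N. f 0 + d (- int N - 1) - d (int N)) \<longlonglongrightarrow> f 0 + 0 - 0"
    by (intro tendsto_intros lim1 lim2)
  thus ?thesis by (simp add: sum)
qed

section \<open>Theta and Gaussian series over the integers, and Poisson summation\<close>

lemma summable_on_gaussian_int:
  fixes b c :: real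
  assumes "c > 0"
  shows "(\<lambda>m::int. exp (- c * (of_int m + b)\<^sup>2)) summable_on UNIV"
proof -
  define r where "r = exp (- 2 * c)"
  have r: "0 < r" "r < 1" using assms by (auto simp: r_def)
  define g where "g m = r ^ nat \<bar>m\<bar>" for m :: int
  have geo: "(\<lambda>n::nat. r ^ n) summable_on UNIV"
    using r by (intro norm_summable_imp_summable_on) simp
  have "g summable_on range int"
    by (subst summable_on_reindex) (use geo in \<open>auto simp: g_def o_def\<close>)
  moreover have "g summable_on range (\<lambda>n. - int n)"
    by (subst summable_on_reindex) (use geo in \<open>auto simp: g_def o_def inj_on_def\<close>)
  moreover have "UNIV = range int \<union> range (\<lambda>n. - int n)"
    by (auto simp: image_iff) (metis int_cases2)
  ultimately have "g summable_on UNIV"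
    using summable_on_union [of g "range int" "range (\<lambda>n. - int n)"] by simp
  hence "(\<lambda>m. exp (c * (2 * \<bar>b\<bar> + 1)) * g m) summable_on UNIV"
    by (rule summable_on_cmult_right)
  thus ?thesis
  proof (rule summable_on_comparison_test)
    fix m :: int
    \<comment> \<open>The tangent bound \<open>2 * t - 1 \<le> t\<^sup>2\<close> turns Gaussian
      decay into geometric decay in \<open>\<bar>m\<bar>\<close>, with ratio
      \<open>exp (- 2 * c)\<close>.\<close>
    have "0 \<le> (\<bar>of_int m + b\<bar> - 1)\<^sup>2" by simp
    hence 1: "2 * \<bar>of_int m + b\<bar> - 1 \<le> (of_int m + b)\<^sup>2"
      by (simp add: power2_diff)
    have 2: "\<bar>real_of_int m\<bar> \<le> \<bar>of_int m + b\<bar> + \<bar>b\<bar>" by arith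
    have "- s \<le> 2 * b' + 1 - 2 * a" if "2 * t - 1 \<le> s" "a \<le> t + b'" for s t a b' :: real
      using that by linarith
    from this [OF 1 2] have "- (of_int m + b)\<^sup>2 \<le> 2 * \<bar>b\<bar> + 1 - 2 * \<bar>of_int m\<bar>" .
    hence "c * - (of_int m + b)\<^sup>2 \<le> c * (2 * \<bar>b\<bar> + 1 - 2 * \<bar>of_int m\<bar>)"
      using assms by (intro mult_left_mono) auto
    hence "exp (- c * (of_int m + b)\<^sup>2) \<le> exp (c * (2 * \<bar>b\<bar> + 1) + real (nat \<bar>m\<bar>) * (- 2 * c))"
      by (simp add: algebra_simps)
    also have "\<dots> = exp (c * (2 * \<bar>b\<bar> + 1)) * g m"
      unfolding exp_add g_def r_def by (simp only: exp_of_nat_mult)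
    finally show "exp (- c * (of_int m + b)\<^sup>2) \<le> exp (c * (2 * \<bar>b\<bar> + 1)) * g m" .
  qed auto
qed

text \<open>Link between the two notions of summation in use: Fourier inversion and the pentagonal
  theorem yield limits of symmetric partial sums, while splitting and reindexing are done with
  unordered sums.\<close>

lemma symmetric_sums_LIMSEQ:
  fixes f :: "int \<Rightarrow> 'a :: {comm_monoid_add, topological_space}"
  assumes "(f has_sum S) UNIV"
  shows "(\<lambda>N. \<Sum>j\<in>{- int N..int N}. f j) \<longlonglongrightarrow> S"
proof -
  have "filterlim (\<lambda>N. {- int N..int N}) (finite_subsets_at_top UNIV) sequentially"
    unfolding filterlim_finite_subsets_at_top
  proof safe
    fix X :: "int set" assume X: "finite X"
    define N where "N = Max (insert 0 ((\<lambda>j. nat \<bar>j\<bar>) ` X))"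
    have "\<bar>j\<bar> \<le> int N" if "j \<in> X" for j
    proof -
      have "nat \<bar>j\<bar> \<le> N" unfolding N_def using X that by (intro Max_ge) auto
      thus ?thesis by linarith
    qed
    hence "X \<subseteq> {- int n..int n}" if "n \<ge> N" for n
      using that by fastforce
    thus "\<forall>\<^sub>F n in sequentially. finite {- int n..int n} \<and> X \<subseteq> {- int n..int n} \<and> {- int n..int n} \<subseteq> UNIV"
      unfolding eventually_sequentially by blast
  qed
  from filterlim_compose [OF assms [unfolded has_sum_def] this] show ?thesis .
qed

text \<open>The general term \<open>q^(j^2) * x^j\<close> of Jacobi's theta series, with
  \<open>q = exp (- pi / l)\<close> and \<open>x = exp (2 * pi * v)\<close>. The argument is complex
  so that adding \<open>\<i> / 2\<close> can produce alternating signs.\<close>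

definition theta_term :: "real \<Rightarrow> complex \<Rightarrow> int \<Rightarrow> complex" where
  "theta_term l v j = exp (of_real (2 * pi * of_int j) * v - of_real (pi / l * (of_int j)\<^sup>2))"

definition gauss_term :: "real \<Rightarrow> complex \<Rightarrow> int \<Rightarrow> complex" where
  "gauss_term l v m = exp (of_real (pi * l) * (v + \<i> * of_int m)\<^sup>2)"

lemma norm_gauss_term:
  "norm (gauss_term l v m) = exp (pi * l * (Re v)\<^sup>2) * exp (- (pi * l) * (of_int m + Im v)\<^sup>2)"
  unfolding gauss_term_def norm_exp_eq_Re exp_add [symmetric]
  by (intro arg_cong [where f = exp]) (simp add: Re_power2 algebra_simps)

lemma norm_theta_term:
  assumes "l > 0"
  shows "norm (theta_term l v j) = exp (pi * l * (Re v)\<^sup>2) * exp (- (pi / l) * (of_int j + - l * Re v)\<^sup>2)"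
  unfolding theta_term_def norm_exp_eq_Re exp_add [symmetric]
  by (intro arg_cong [where f = exp]) (use assms in \<open>simp add: field_simps power2_eq_square\<close>)

lemma abs_summable_gauss_term:
  assumes "l > 0"
  shows "(\<lambda>m. norm (gauss_term l v m)) summable_on A"
  by (rule summable_on_subset_banach [OF _ subset_UNIV]) (unfold norm_gauss_term, intro summable_on_cmult_right summable_on_gaussian_int, use assms in auto)

lemma abs_summable_theta_term:
  assumes "l > 0"
  shows "(\<lambda>j. norm (theta_term l v j)) summable_on A"
  by (rule summable_on_subset_banach [OF _ subset_UNIV]) (unfold norm_theta_term [OF assms], intro summable_on_cmult_right summable_on_gaussian_int, use assms in auto)

lemma summable_gauss_term: "l > 0 \<Longrightarrow> gauss_term l v summable_on A"
  by (rule abs_summable_summable) (rule abs_summable_gauss_term)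

lemma summable_theta_term: "l > 0 \<Longrightarrow> theta_term l v summable_on A"
  by (rule abs_summable_summable) (rule abs_summable_theta_term)

text \<open>An affine substitution with slope \<open>c = sqrt (2 * pi * l)\<close> turns the real
  Gaussian factor into the standard normal density. The remaining oscillation has frequency
  \<open>s\<close>, so the integral is the characteristic function at \<open>s\<close>;
  \<open>K\<close> collects the factors free of \<open>y\<close>.\<close>

lemma gaussian_fourier_integral:
  fixes v :: complex and j :: int
  assumes l: "l > 0"
  defines "\<phi> \<equiv> \<lambda>y::real. exp (of_real (pi * l) * (v + \<i> * of_real y)\<^sup>2) * exp (of_real (- 2 * pi * of_int j * y) * \<i>)"
  shows "integrable lborel \<phi>" "integral\<^sup>L lborel \<phi> = theta_term l v j / of_real (sqrt l)"
proof -
  define c where "c = sqrt (2 * pi * l)"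
  have c: "c > 0" "c\<^sup>2 = 2 * pi * l" using l by (auto simp: c_def)
  define a b where "a = Re v" and "b = Im v"
  define s where "s = 2 * pi * (l * a - of_int j) / c"
  define g where "g x = std_normal_density x *\<^sub>R iexp (s * x)" for x
  define K where "K = exp (of_real (pi * l * a\<^sup>2) + of_real (2 * pi * of_int j * b) * \<i>)"
  interpret real_distribution std_normal_distribution by (rule real_dist_normal_dist)
  have "integrable std_normal_distribution (\<lambda>x. iexp (s * x))"
    by (rule integrable_iexp) auto
  hence int_g: "integrable lborel g"
    unfolding g_def by (subst (asm) integrable_density) auto
  have "integral\<^sup>L lborel g = char std_normal_distribution s"
    unfolding g_def char_def by (subst integral_density) auto
  also have "\<dots> = of_real (exp (- s\<^sup>2 / 2))"
    by (simp add: char_std_normal_distribution)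
  finally have g_val: "integral\<^sup>L lborel g = of_real (exp (- s\<^sup>2 / 2))" .
  have v: "v = of_real a + \<i> * of_real b" by (simp add: a_def b_def complex_eq)
  have \<phi>: "\<phi> y = of_real (sqrt (2 * pi)) * K * g (c * b + c * y)" for y
  proof -
    have 1: "s * (c * b + c * y) = 2 * pi * (l * a - of_int j) * (b + y)"
      using c by (simp add: s_def field_simps)
    have 2: "(c * b + c * y)\<^sup>2 / 2 = pi * l * (b + y)\<^sup>2"
      using c by (simp add: power_mult_distrib flip: distrib_left)
    have "\<phi> y = exp (of_real (pi * l) * (of_real a + \<i> * of_real (b + y))\<^sup>2 - of_real (2 * pi * of_int j * y) * \<i>)"
      unfolding \<phi>_def exp_add [symmetric] v by (simp add: algebra_simps)
    also have "of_real (pi * l) * (of_real a + \<i> * of_real (b + y))\<^sup>2 - of_real (2 * pi * of_int j * y) * \<i> =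
      (of_real (pi * l * a\<^sup>2) + of_real (2 * pi * of_int j * b) * \<i>) + of_real (- ((c * b + c * y)\<^sup>2 / 2)) + \<i> * of_real (s * (c * b + c * y))"
      unfolding 1 2 by (simp add: complex_eq_iff Re_power2 Im_power2) (simp add: power2_eq_square algebra_simps)
    also have "exp \<dots> = K * exp (of_real (- ((c * b + c * y)\<^sup>2 / 2))) * iexp (s * (c * b + c * y))"
      by (simp only: exp_add K_def)
    also have "\<dots> = of_real (sqrt (2 * pi)) * K * g (c * b + c * y)"
      unfolding g_def std_normal_density_def by (simp add: scaleR_conv_of_real exp_of_real [symmetric])
    finally show ?thesis .
  qed
  have "integrable lborel (\<lambda>y. g (c * b + c * y))"
    using int_g c by (intro lborel_integrable_real_affine) auto
  thus "integrable lborel \<phi>" unfolding \<phi> [abs_def] by (intro integrable_mult_right)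
  have sc: "sqrt (2 * pi) / c = 1 / sqrt l"
    using l by (simp add: c_def real_sqrt_mult)
  have s2: "s\<^sup>2 / 2 = pi * (l * a - of_int j)\<^sup>2 / l"
    using l by (simp add: s_def power_divide c power_mult_distrib) (simp add: power2_eq_square field_simps)
  have "integral\<^sup>L lborel (\<lambda>y. g (c * b + c * y)) = of_real (exp (- s\<^sup>2 / 2)) / of_real c"
    using lborel_integral_real_affine [of c g "c * b"] c g_val
    by (simp add: scaleR_conv_of_real field_simps)
  hence "integral\<^sup>L lborel \<phi> = of_real (sqrt (2 * pi)) * K * (of_real (exp (- s\<^sup>2 / 2)) / of_real c)"
    unfolding \<phi> [abs_def] by simp
  also have "\<dots> = of_real (sqrt (2 * pi) / c) * (K * exp (of_real (- (s\<^sup>2 / 2))))"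
    by (simp flip: exp_of_real)
  also have "K * exp (of_real (- (s\<^sup>2 / 2))) = theta_term l v j"
    unfolding K_def theta_term_def exp_add [symmetric] s2 v using l
    by (intro arg_cong [where f = exp]) (simp add: complex_eq_iff, simp add: field_simps power2_eq_square)
  finally show "integral\<^sup>L lborel \<phi> = theta_term l v j / of_real (sqrt l)"
    by (simp add: sc)
qed

text \<open>The sum \<open>f w\<close> of the Gaussians at \<open>v + w\<close> is holomorphic, and
  its \<open>j\<close>-th Fourier coefficient on the unit segment along the imaginary axis unfolds
  to a Gaussian integral over the whole line, namely \<open>theta_term l v j / sqrt l\<close>.
  Fourier inversion at \<open>w = 0\<close> gives the formula.\<close>

theorem theta_transformation:
  assumes l: "l > 0"
  shows "(\<Sum>\<^sub>\<infinity>j. theta_term l v j) = of_real (sqrt l) * (\<Sum>\<^sub>\<infinity>m. gauss_term l v m)"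
proof -
  let ?I = "{-1/2..1/2::real}"
  define f where "f w = (\<Sum>\<^sub>\<infinity>m. gauss_term l (v + w) m)" for w
  \<comment> \<open>A majorant valid for all \<open>w\<close> in the closed unit disc. Halving the
    Gaussian rate comes from \<open>(x + y)\<^sup>2 \<ge> x\<^sup>2 / 2 - y\<^sup>2\<close>, and
    \<open>y\<^sup>2 \<le> 1\<close> accounts for the extra \<open>+ 1\<close> in the
    constant.\<close>
  define M where "M m = exp (pi * l * ((\<bar>Re v\<bar> + 1)\<^sup>2 + 1)) * exp (- (pi * l / 2) * (of_int m + Im v)\<^sup>2)"
    for m :: int
  have M: "M summable_on UNIV"
    unfolding M_def by (intro summable_on_cmult_right summable_on_gaussian_int) (use l in auto)
  have bound: "norm (gauss_term l (v + w) m) \<le> M m" if w: "w \<in> cball 0 1" for w m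
  proof -
    have "\<bar>Re w\<bar> \<le> 1" "\<bar>Im w\<bar> \<le> 1"
      using w abs_Re_le_cmod [of w] abs_Im_le_cmod [of w] by auto
    have 1: "(Re v + Re w)\<^sup>2 \<le> (\<bar>Re v\<bar> + 1)\<^sup>2"
      using \<open>\<bar>Re w\<bar> \<le> 1\<close> by (intro power2_le_iff_abs_le [THEN iffD2]) auto
    have "(Im w)\<^sup>2 \<le> 1" using \<open>\<bar>Im w\<bar> \<le> 1\<close> by (simp add: abs_square_le_1)
    moreover have "(of_int m + (Im v + Im w))\<^sup>2 =
        (of_int m + Im v)\<^sup>2 / 2 - (Im w)\<^sup>2 + (of_int m + Im v + 2 * Im w)\<^sup>2 / 2"
      by (simp add: field_simps power2_eq_square)
    moreover have "0 \<le> (of_int m + Im v + 2 * Im w)\<^sup>2 / 2" by simp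
    moreover have "a / 2 - 1 \<le> s" if "b \<le> 1" "s = a / 2 - b + c" "0 \<le> c" for a b c s :: real
      using that by linarith
    ultimately have 2: "(of_int m + (Im v + Im w))\<^sup>2 \<ge> (of_int m + Im v)\<^sup>2 / 2 - 1"
      by blast
    have "(Re v + Re w)\<^sup>2 - (of_int m + (Im v + Im w))\<^sup>2 \<le> (\<bar>Re v\<bar> + 1)\<^sup>2 + 1 - (of_int m + Im v)\<^sup>2 / 2"
      using 1 2 by linarith
    hence "pi * l * ((Re v + Re w)\<^sup>2 - (of_int m + (Im v + Im w))\<^sup>2) \<le> pi * l * ((\<bar>Re v\<bar> + 1)\<^sup>2 + 1 - (of_int m + Im v)\<^sup>2 / 2)"
      using l by (intro mult_left_mono) auto
    thus ?thesis
      unfolding norm_gauss_term M_def exp_add [symmetric] by (simp add: right_diff_distrib)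
  qed
  have sum_f: "((\<lambda>m. gauss_term l (v + w) m) has_sum f w) UNIV" for w
    unfolding f_def by (rule has_sum_infsum [OF summable_gauss_term [OF l]])
  have ul: "uniform_limit (cball 0 1) (\<lambda>X w. \<Sum>m\<in>X. gauss_term l (v + w) m) f (finite_subsets_at_top UNIV)"
    by (rule Weierstrass_m_test_general' [OF _ sum_f M]) (use bound in auto)
  have "\<forall>\<^sub>F X in finite_subsets_at_top UNIV. continuous_on (cball 0 1) (\<lambda>w. \<Sum>m\<in>X. gauss_term l (v + w) m)
          \<and> (\<lambda>w. \<Sum>m\<in>X. gauss_term l (v + w) m) holomorphic_on ball 0 1"
    unfolding gauss_term_def by (intro always_eventually allI conjI continuous_intros holomorphic_intros)
  from holomorphic_uniform_limit [OF this ul] have hol: "f holomorphic_on ball 0 1"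
    by (meson finite_subsets_at_top_neq_bot)
  have coeff: "((\<lambda>y. f (\<i> * of_real y) * exp (of_real (- 2 * pi * of_int j * y) * \<i>))
                  has_integral theta_term l v j / of_real (sqrt l)) ?I" for j
  proof -
    define e where "e y = exp (of_real (- 2 * pi * of_int j * y) * \<i>)" for y :: real
    define \<phi> where "\<phi> y = exp (of_real (pi * l) * (v + \<i> * of_real y)\<^sup>2) * e y" for y :: real
    have int\<phi>: "integrable lborel \<phi>" and val\<phi>: "integral\<^sup>L lborel \<phi> = theta_term l v j / of_real (sqrt l)"
      using gaussian_fourier_integral [OF l, of v j] unfolding \<phi>_def e_def by auto
    have cont\<phi>: "continuous_on A \<phi>" for A
      unfolding \<phi>_def e_def by (intro continuous_intros)
    define i where "i m = integral {-1/2 + of_int m..1/2 + of_int m} \<phi>" for m :: int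
    have i: "(\<phi> has_integral i m) {-1/2 + of_int m..1/2 + of_int m}" for m
      unfolding i_def by (intro integrable_integral integrable_continuous_real cont\<phi>)
    \<comment> \<open>The character \<open>e\<close> has period 1, so translating
      \<open>\<phi>\<close> by \<open>m\<close> changes only the Gaussian, which becomes its
      \<open>m\<close>-th summand. Integrals over unit intervals of the line thus turn into
      integrals over \<open>?I\<close>.\<close>
    have shift: "\<phi> (of_int m + y) = gauss_term l (v + \<i> * of_real y) m * e y" for m y
    proof -
      have "e (of_int m + y) = e y * exp (of_int (2 * (- j * m)) * of_real pi * \<i>)"
        unfolding e_def exp_add [symmetric] by (intro arg_cong [where f = exp]) (simp add: algebra_simps)
      also have "exp (of_int (2 * (- j * m)) * of_real pi * \<i>) = 1"
        by (subst exp_eq_1) (auto intro!: exI [of _ "- j * m"])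
      finally show ?thesis
        by (simp add: \<phi>_def gauss_term_def algebra_simps)
    qed
    have i': "((\<lambda>y. gauss_term l (v + \<i> * of_real y) m * e y) has_integral i m) ?I" for m
      using i [of m] has_integral_shift_Icc_real [of \<phi> "of_int m" "i m" "-1/2" "1/2"]
      by (simp add: o_def shift)
    have ul: "uniform_limit ?I (\<lambda>X y. \<Sum>m\<in>X. gauss_term l (v + \<i> * of_real y) m * e y)
                (\<lambda>y. f (\<i> * of_real y) * e y) (finite_subsets_at_top UNIV)"
    proof (rule Weierstrass_m_test_general' [OF _ has_sum_cmult_left [OF sum_f] M])
      fix m y assume "y \<in> ?I"
      hence "\<i> * of_real y \<in> cball 0 1" by (auto simp: norm_mult)
      thus "norm (gauss_term l (v + \<i> * of_real y) m * e y) \<le> M m"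
        using bound by (simp add: norm_mult e_def)
    qed
    obtain S J where S: "\<And>X. ((\<lambda>y. \<Sum>m\<in>X. gauss_term l (v + \<i> * of_real y) m * e y) has_integral S X) ?I"
      and J: "((\<lambda>y. f (\<i> * of_real y) * e y) has_integral J) ?I"
      and SJ: "(S \<longlongrightarrow> J) (finite_subsets_at_top UNIV)"
      by (rule uniform_limit_integral [OF ul])
         (auto simp: gauss_term_def e_def intro!: continuous_intros)
    have "S X = sum i X" if "finite X" for X
      by (rule has_integral_unique [OF S]) (use that i' in \<open>intro has_integral_sum\<close>)
    hence "(sum i \<longlongrightarrow> J) (finite_subsets_at_top UNIV)"
      using SJ by (rule_tac Lim_transform_eventually) (auto intro: eventually_finite_subsets_at_top_weakI)
    hence "(i has_sum J) UNIV" by (simp add: has_sum_def)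
    from symmetric_sums_LIMSEQ [OF this] have lim1: "(\<lambda>N. \<Sum>m\<in>{- int N..int N}. i m) \<longlonglongrightarrow> J" .
    \<comment> \<open>The union of the \<open>2 * N + 1\<close> unit intervals centred at the
      integers from \<open>- N\<close> to \<open>N\<close>; dominated convergence over these sets
      recovers the integral over the line.\<close>
    define T where "T N = {- real N - 1/2..real N + 1/2}" for N
    have sum_i: "(\<phi> has_integral (\<Sum>m\<in>{- int N..int N}. i m)) (T N)" for N
    proof (induction N)
      case 0
      then show ?case using i [of 0] by (simp add: T_def)
    next
      case (Suc N)
      have s: "{- int (Suc N)..int (Suc N)} = insert (int (Suc N)) (insert (- int (Suc N)) {- int N..int N})"
        by auto
      have "- 1/2 + real_of_int (- int (Suc N)) = - real (Suc N) - 1/2" "1/2 + real_of_int (- int (Suc N)) = - real N - 1/2"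
           "- 1/2 + real_of_int (int (Suc N)) = real N + 1/2" "1/2 + real_of_int (int (Suc N)) = real (Suc N) + 1/2"
        by simp_all
      note i1 = i [of "- int (Suc N)", unfolded this] and i2 = i [of "int (Suc N)", unfolded this]
      have "(\<phi> has_integral (i (- int (Suc N)) + (\<Sum>m\<in>{- int N..int N}. i m))) {- real (Suc N) - 1/2..real N + 1/2}"
        by (rule has_integral_combine [where c = "- real N - 1/2"])
           (rule i1 Suc [unfolded T_def] | simp)+
      hence "(\<phi> has_integral (i (- int (Suc N)) + (\<Sum>m\<in>{- int N..int N}. i m) + i (int (Suc N)))) (T (Suc N))"
        unfolding T_def
        by (rule has_integral_combine [where c = "real N + 1/2", rotated 2])
           (rule i2 | simp)+
      then show ?case unfolding s by (simp add: algebra_simps)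
    qed
    have "(\<lambda>N. \<integral>x. indicator (T N) x *\<^sub>R \<phi> x \<partial>lborel) \<longlonglongrightarrow> integral\<^sup>L lborel \<phi>"
    proof (rule integral_dominated_convergence [where w = "\<lambda>x. norm (\<phi> x)"])
      show "\<phi> \<in> borel_measurable lborel" using int\<phi> by auto
      show "integrable lborel (\<lambda>x. norm (\<phi> x))" using int\<phi> by auto
      show "(\<lambda>x. indicator (T N) x *\<^sub>R \<phi> x) \<in> borel_measurable lborel" for N
        using int\<phi> by (intro borel_measurable_scaleR) (auto simp: T_def)
      show "AE x in lborel. (\<lambda>N. indicator (T N) x *\<^sub>R \<phi> x) \<longlonglongrightarrow> \<phi> x"
      proof (intro AE_I2 tendsto_eventually)
        fix x :: real
        have "x \<in> T N" if "N \<ge> nat \<lceil>\<bar>x\<bar>\<rceil>" for N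
          using that unfolding T_def by (auto simp: nat_le_iff ceiling_le_iff abs_le_iff)
        thus "\<forall>\<^sub>F N in sequentially. indicator (T N) x *\<^sub>R \<phi> x = \<phi> x"
          by (auto simp: eventually_sequentially intro!: exI [of _ "nat \<lceil>\<bar>x\<bar>\<rceil>"])
      qed
      show "AE x in lborel. norm (indicator (T N) x *\<^sub>R \<phi> x) \<le> norm (\<phi> x)" for N
        by (auto simp: indicator_def)
    qed
    moreover have "(\<integral>x. indicator (T N) x *\<^sub>R \<phi> x \<partial>lborel) = (\<Sum>m\<in>{- int N..int N}. i m)" for N
    proof -
      have "set_integrable lborel (T N) \<phi>"
        unfolding set_integrable_def by (rule integrable_mult_indicator [OF _ int\<phi>]) (auto simp: T_def)
      from set_borel_integral_eq_integral(2) [OF this] show ?thesis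
        using integral_unique [OF sum_i] by (simp add: set_lebesgue_integral_def)
    qed
    ultimately have "(\<lambda>N. \<Sum>m\<in>{- int N..int N}. i m) \<longlonglongrightarrow> theta_term l v j / of_real (sqrt l)"
      by (simp add: val\<phi>)
    from LIMSEQ_unique [OF lim1 this] show ?thesis using J by (simp add: e_def)
  qed
  have "(\<lambda>N. \<Sum>j\<in>{- int N..int N}. theta_term l v j / of_real (sqrt l)) \<longlonglongrightarrow> f 0"
    by (rule fourier_series_holomorphic [OF hol coeff])
  moreover have "(\<lambda>N. \<Sum>j\<in>{- int N..int N}. theta_term l v j / of_real (sqrt l)) \<longlonglongrightarrow>
                   (\<Sum>\<^sub>\<infinity>j. theta_term l v j) / of_real (sqrt l)"
    unfolding sum_divide_distrib [symmetric]
    by (intro tendsto_divide tendsto_const symmetric_sums_LIMSEQ has_sum_infsum summable_theta_term)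
       (use l in auto)
  ultimately have "f 0 = (\<Sum>\<^sub>\<infinity>j. theta_term l v j) / of_real (sqrt l)"
    by (rule LIMSEQ_unique)
  thus ?thesis using l by (simp add: f_def field_simps)
qed

subsection \<open>Asymptotics of theta series\<close>

text \<open>For \<open>l \<ge> 1\<close> and \<open>x \<ge> d\<close> one has
  \<open>- l * (x - d) \<le> - (x - d)\<close>. After extracting \<open>exp (- pi * l * d)\<close>
  the rest is therefore bounded by its value at \<open>l = 1\<close>, so the constant depends only
  on \<open>b\<close> and \<open>d\<close>, not on \<open>l\<close>, \<open>Re v\<close> or
  \<open>A\<close>.\<close>

lemma gauss_tail:
  fixes b d :: real
  obtains C where "C \<ge> 0" "\<And>l v A. l \<ge> 1 \<Longrightarrow> Im v = b \<Longrightarrow> (\<And>m. m \<in> A \<Longrightarrow> d \<le> (of_int m + b)\<^sup>2) \<Longrightarrow>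
     norm (\<Sum>\<^sub>\<infinity>m\<in>A. gauss_term l v m) \<le> C * exp (pi * l * ((Re v)\<^sup>2 - d))"
proof
  define h where "h m = exp (pi * d) * exp (- pi * (of_int m + b)\<^sup>2)" for m :: int
  have h: "h summable_on A" for A
    by (rule summable_on_subset_banach [OF _ subset_UNIV], unfold h_def)
       (intro summable_on_cmult_right summable_on_gaussian_int, simp)
  show "infsum h UNIV \<ge> 0" by (rule infsum_nonneg) (simp add: h_def)
  fix l :: real and v :: complex and A :: "int set"
  assume l: "l \<ge> 1" and v: "Im v = b" and A: "\<And>m. m \<in> A \<Longrightarrow> d \<le> (of_int m + b)\<^sup>2"
  let ?K = "exp (pi * l * ((Re v)\<^sup>2 - d))"
  have le: "norm (gauss_term l v m) \<le> ?K * h m" if "m \<in> A" for m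
  proof -
    have "0 \<le> pi * ((l - 1) * ((of_int m + b)\<^sup>2 - d))"
      using l A [OF that] by simp
    thus ?thesis
      unfolding norm_gauss_term h_def exp_add [symmetric] v by (simp add: algebra_simps)
  qed
  have "norm (\<Sum>\<^sub>\<infinity>m\<in>A. gauss_term l v m) \<le> (\<Sum>\<^sub>\<infinity>m\<in>A. norm (gauss_term l v m))"
    using l by (intro norm_infsum_bound abs_summable_gauss_term) auto
  also have "\<dots> \<le> (\<Sum>\<^sub>\<infinity>m\<in>A. ?K * h m)"
    using l by (intro infsum_mono abs_summable_gauss_term summable_on_cmult_right h le) auto
  also have "\<dots> \<le> (\<Sum>\<^sub>\<infinity>m. ?K * h m)"
    by (intro infsum_mono_neutral summable_on_cmult_right h) (auto simp: h_def)
  also have "\<dots> = infsum h UNIV * ?K"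
    unfolding infsum_cmult_right' by (rule mult.commute)
  finally show "norm (\<Sum>\<^sub>\<infinity>m\<in>A. gauss_term l v m) \<le> infsum h UNIV * ?K" .
qed

lemma infsum_gauss_split:
  assumes "l > 0" "finite F"
  shows "(\<Sum>\<^sub>\<infinity>m. gauss_term l v m) = (\<Sum>m\<in>F. gauss_term l v m) + (\<Sum>\<^sub>\<infinity>m\<in>-F. gauss_term l v m)"
  using infsum_Un_disjoint [OF summable_gauss_term [of l v F] summable_gauss_term [of l v "- F"]] assms
  by simp

text \<open>The indices \<open>m\<close> and \<open>- 1 - m\<close> give the imaginary parts
  \<open>m + 1/2\<close> and \<open>- (m + 1/2)\<close>, so the two Gaussians are complex conjugates
  and add up to twice a real part.\<close>

lemma gauss_term_pair:
  fixes v l :: real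
  shows "gauss_term l (v + \<i> / 2) m + gauss_term l (v + \<i> / 2) (- 1 - m) =
         of_real (2 * exp (pi * l * (v\<^sup>2 - (of_int m + 1 / 2)\<^sup>2)) * cos (pi * l * v * (2 * of_int m + 1)))"
proof -
  let ?a = "pi * l * (v\<^sup>2 - (of_int m + 1 / 2)\<^sup>2)" and ?t = "pi * l * v * (2 * of_int m + 1)"
  have 1: "gauss_term l (v + \<i> / 2) m = of_real (exp ?a) * cis ?t"
    unfolding gauss_term_def cis_conv_exp exp_of_real [symmetric] exp_add [symmetric]
    by (intro arg_cong [where f = exp]) (simp add: complex_eq_iff, simp add: power2_eq_square algebra_simps)
  have 2: "gauss_term l (v + \<i> / 2) (- 1 - m) = of_real (exp ?a) * cis (- ?t)"
    unfolding gauss_term_def cis_conv_exp exp_of_real [symmetric] exp_add [symmetric]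
    by (intro arg_cong [where f = exp]) (simp add: complex_eq_iff, simp add: power2_eq_square algebra_simps)
  show ?thesis unfolding 1 2 by (simp add: complex_eq_iff)
qed

text \<open>Only \<open>m = 0\<close> is kept after the transformation; every other index has
  \<open>m\<^sup>2 \<ge> 1\<close>, which gives the relative error
  \<open>exp (- pi * l)\<close>.\<close>

lemma infsum_theta_term_approx:
  obtains C where "C \<ge> 0" "\<And>l v::real. l \<ge> 1 \<Longrightarrow>
     norm ((\<Sum>\<^sub>\<infinity>j. theta_term l v j) - of_real (sqrt l * exp (pi * l * v\<^sup>2)))
       \<le> C * (sqrt l * exp (pi * l * v\<^sup>2)) * exp (- pi * l)"
proof -
  obtain C where C: "C \<ge> 0" "\<And>l v A. l \<ge> 1 \<Longrightarrow> Im v = 0 \<Longrightarrow> (\<And>m. m \<in> A \<Longrightarrow> 1 \<le> (of_int m + (0::real))\<^sup>2) \<Longrightarrow>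
     norm (\<Sum>\<^sub>\<infinity>m\<in>A. gauss_term l v m) \<le> C * exp (pi * l * ((Re v)\<^sup>2 - 1))"
    by (rule gauss_tail [where b = 0 and d = 1]) blast
  show thesis
  proof (rule that [OF C(1)])
    fix l v :: real
    assume l: "l \<ge> 1"
    let ?R = "\<Sum>\<^sub>\<infinity>m\<in>-{0}. gauss_term l v m"
    have R: "norm ?R \<le> C * exp (pi * l * (v\<^sup>2 - 1))"
    proof -
      have "1 \<le> (real_of_int m)\<^sup>2" if "m \<noteq> 0" for m
      proof -
        have "1 \<le> \<bar>real_of_int m\<bar>" using that by linarith
        thus ?thesis using abs_le_square_iff [of 1 "real_of_int m"] by simp
      qed
      thus ?thesis using C(2) [OF l, of v "-{0}"] by simp
    qed
    have "(\<Sum>\<^sub>\<infinity>j. theta_term l v j) = of_real (sqrt l) * (gauss_term l v 0 + ?R)"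
      using theta_transformation [of l v] infsum_gauss_split [of l "{0}" v] l by simp
    also have "gauss_term l v 0 = of_real (exp (pi * l * v\<^sup>2))"
      by (simp add: gauss_term_def flip: exp_of_real)
    finally have "(\<Sum>\<^sub>\<infinity>j. theta_term l v j) - of_real (sqrt l * exp (pi * l * v\<^sup>2)) = of_real (sqrt l) * ?R"
      by (simp add: algebra_simps)
    moreover have "norm (of_real (sqrt l) * ?R) \<le> sqrt l * (C * exp (pi * l * (v\<^sup>2 - 1)))"
      using R l by (simp add: norm_mult mult_left_mono)
    moreover have "sqrt l * (C * exp (pi * l * (v\<^sup>2 - 1))) = C * (sqrt l * exp (pi * l * v\<^sup>2)) * exp (- pi * l)"
      by (simp add: right_diff_distrib exp_diff exp_minus field_simps)
    ultimately show "norm ((\<Sum>\<^sub>\<infinity>j. theta_term l v j) - of_real (sqrt l * exp (pi * l * v\<^sup>2)))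
       \<le> C * (sqrt l * exp (pi * l * v\<^sup>2)) * exp (- pi * l)" by metis
  qed
qed

lemma half_int_square_ge:
  fixes k :: nat and m :: int
  assumes "m \<ge> int k \<or> m \<le> - 1 - int k"
  shows "(real k + 1 / 2)\<^sup>2 \<le> (of_int m + 1 / 2)\<^sup>2"
proof -
  have "real k \<le> of_int m \<or> of_int m \<le> - 1 - real k"
    using assms by linarith
  thus ?thesis by (subst abs_le_square_iff [symmetric]) auto
qed

text \<open>The indices \<open>0\<close> and \<open>-1\<close> form the cosine pair. The next ones
  have \<open>(m + 1/2)\<^sup>2 \<ge> 9/4\<close>, which is 2 more than the \<open>1/4\<close> of
  the pair, hence the rate \<open>2 * pi * l\<close>.\<close>

lemma infsum_theta_term_half_approx:
  obtains C where "C \<ge> 0" "\<And>l v::real. l \<ge> 1 \<Longrightarrow>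
     norm ((\<Sum>\<^sub>\<infinity>j. theta_term l (v + \<i> / 2) j) - of_real (2 * sqrt l * exp (pi * l * (v\<^sup>2 - 1 / 4)) * cos (pi * l * v)))
       \<le> C * (2 * sqrt l * exp (pi * l * (v\<^sup>2 - 1 / 4))) * exp (- 2 * pi * l)"
proof -
  obtain C where C: "C \<ge> 0" "\<And>l v A. l \<ge> 1 \<Longrightarrow> Im v = 1/2 \<Longrightarrow> (\<And>m. m \<in> A \<Longrightarrow> 9/4 \<le> (of_int m + (1/2::real))\<^sup>2) \<Longrightarrow>
     norm (\<Sum>\<^sub>\<infinity>m\<in>A. gauss_term l v m) \<le> C * exp (pi * l * ((Re v)\<^sup>2 - 9/4))"
    by (rule gauss_tail [where b = "1/2" and d = "9/4"]) blast
  show thesis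
  proof (rule that)
    show "C / 2 \<ge> 0" using C by simp
    fix l v :: real
    assume l: "l \<ge> 1"
    let ?R = "\<Sum>\<^sub>\<infinity>m\<in>-{0,-1}. gauss_term l (v + \<i> / 2) m"
    have R: "norm ?R \<le> C * exp (pi * l * (v\<^sup>2 - 9/4))"
    proof -
      have "9/4 \<le> (real_of_int m + 1/2)\<^sup>2" if "m \<in> -{0,-1}" for m
        proof -
        have "m \<ge> int 1 \<or> m \<le> - 1 - int 1" using that by simp arith
        from half_int_square_ge [OF this] show ?thesis by (simp add: power2_eq_square)
      qed
      thus ?thesis using C(2) [OF l, of "v + \<i> / 2" "-{0,-1}"] by simp
    qed
    have "(\<Sum>\<^sub>\<infinity>j. theta_term l (v + \<i> / 2) j) =
            of_real (sqrt l) * (gauss_term l (v + \<i> / 2) 0 + gauss_term l (v + \<i> / 2) (- 1 - 0) + ?R)"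
      using theta_transformation [of l "v + \<i> / 2"] infsum_gauss_split [of l "{0,-1}" "v + \<i> / 2"] l by simp
    also have "\<dots> = of_real (2 * sqrt l * exp (pi * l * (v\<^sup>2 - 1/4)) * cos (pi * l * v)) + of_real (sqrt l) * ?R"
      unfolding gauss_term_pair by (simp add: power2_eq_square algebra_simps)
    finally have "(\<Sum>\<^sub>\<infinity>j. theta_term l (v + \<i> / 2) j) - of_real (2 * sqrt l * exp (pi * l * (v\<^sup>2 - 1 / 4)) * cos (pi * l * v))
        = of_real (sqrt l) * ?R"
      by simp
    moreover have "norm (of_real (sqrt l) * ?R) \<le> sqrt l * (C * exp (pi * l * (v\<^sup>2 - 9/4)))"
      using R l by (simp add: norm_mult mult_left_mono)
    moreover have "exp (pi * l * (v\<^sup>2 - 9/4)) = exp (pi * l * (v\<^sup>2 - 1/4)) * exp (- 2 * pi * l)"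
      unfolding exp_add [symmetric] by (simp add: algebra_simps)
    ultimately show "norm ((\<Sum>\<^sub>\<infinity>j. theta_term l (v + \<i> / 2) j) - of_real (2 * sqrt l * exp (pi * l * (v\<^sup>2 - 1 / 4)) * cos (pi * l * v)))
       \<le> C / 2 * (2 * sqrt l * exp (pi * l * (v\<^sup>2 - 1 / 4))) * exp (- 2 * pi * l)"
      by (simp add: algebra_simps)
  qed
qed

lemma theta_term_half:
  "theta_term l (v + \<i> / 2) j = (-1) powi j * theta_term l v j"
proof -
  have "theta_term l (v + \<i> / 2) j = exp (of_int j * (of_real pi * \<i>)) * theta_term l v j"
    unfolding theta_term_def exp_add [symmetric]
    by (intro arg_cong [where f = exp]) (simp add: algebra_simps)
  also have "exp (of_int j * (of_real pi * \<i>)) = (-1) powi j"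
    by (simp flip: exp_power_int)
  finally show ?thesis .
qed

text \<open>The pentagonal number theorem makes \<open>(q; q)\<^sub>\<infinity>\<close> a theta series; the second pair of Gaussians in
  its transform vanishes because of the factor \<open>cos (pi / 2)\<close>.\<close>

lemma qpoch_inf_self_approx:
  obtains C where "C \<ge> 0" "\<And>l. l \<ge> 3 / 2 \<Longrightarrow>
     \<bar>qpoch_inf (exp (- pi / l)) (exp (- pi / l)) / (sqrt (2 * l) * exp (pi / (24 * l) - pi * l / 6)) - 1\<bar> \<le> C * exp (- 4 * pi * l)"
proof -
  \<comment> \<open>Two pairs are split off below, so the tail starts at
    \<open>(5/2)\<^sup>2 = 25/4\<close>. The gap to the leading \<open>1/4\<close> is 6, and
    \<open>6 * L = 4 * l\<close> yields the rate in the claim.\<close>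
  obtain C where C: "C \<ge> 0" "\<And>l v A. l \<ge> 1 \<Longrightarrow> Im v = 1/2 \<Longrightarrow> (\<And>m. m \<in> A \<Longrightarrow> 25/4 \<le> (of_int m + (1/2::real))\<^sup>2) \<Longrightarrow>
     norm (\<Sum>\<^sub>\<infinity>m\<in>A. gauss_term l v m) \<le> C * exp (pi * l * ((Re v)\<^sup>2 - 25/4))"
    by (rule gauss_tail [where b = "1/2" and d = "25/4"]) blast
  show thesis
  proof (rule that)
    show "C \<ge> 0" by fact
    fix l :: real assume l: "l \<ge> 3 / 2"
    define q where "q = exp (- pi / l)"
    have q: "0 < q" "q < 1" using l by (auto simp: q_def)
    \<comment> \<open>Matching \<open>q powr (j * (3 * j + 1) / 2)\<close> with a theta term:
      \<open>pi / L = 3 * pi / (2 * l)\<close> from the quadratic part and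
      \<open>2 * pi * v = - pi / (2 * l)\<close> from the linear part. The bound
      \<open>l \<ge> 3 / 2\<close> is \<open>L \<ge> 1\<close>.\<close>
    define L where "L = 2 * l / 3"
    define v where "v = - 1 / (4 * l)"
    define V where "V = of_real v + \<i> / 2"
    have L: "L \<ge> 1" using l by (simp add: L_def)
    have Lv: "L * v = - 1 / 6" using l by (simp add: L_def v_def)
    have term_eq: "theta_term L V j = of_real ((-1) powi j * q powr (of_int j * (3 * of_int j + 1) / 2))" for j
    proof -
      have "q powr (of_int j * (3 * of_int j + 1) / 2) = exp (2 * pi * of_int j * v - pi / L * (of_int j)\<^sup>2)"
        unfolding q_def v_def L_def powr_def using l
        by (simp add: field_simps power2_eq_square)
      thus ?thesis
        unfolding V_def theta_term_half by (simp add: theta_term_def exp_of_real [symmetric])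
    qed
    have "(\<lambda>n. \<Sum>j\<in>{- int n..int n}. theta_term L V j) \<longlonglongrightarrow> of_real (qpoch_inf q q)"
      unfolding term_eq of_real_sum [symmetric] by (intro tendsto_of_real pentagonal_LIMSEQ q)
    moreover have "(\<lambda>n. \<Sum>j\<in>{- int n..int n}. theta_term L V j) \<longlonglongrightarrow> (\<Sum>\<^sub>\<infinity>j. theta_term L V j)"
      using L by (intro symmetric_sums_LIMSEQ has_sum_infsum summable_theta_term) auto
    ultimately have Q: "of_real (qpoch_inf q q) = (\<Sum>\<^sub>\<infinity>j. theta_term L V j)"
      by (rule LIMSEQ_unique)
    let ?F = "{0,-1,1,-2::int}" and ?g = "\<lambda>m. gauss_term L V m"
    define R where "R = (\<Sum>\<^sub>\<infinity>m\<in>-?F. ?g m)"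
    have R: "norm R \<le> C * exp (pi * L * (v\<^sup>2 - 25/4))"
    proof -
      have "25/4 \<le> (real_of_int m + 1/2)\<^sup>2" if "m \<in> -?F" for m
        proof -
        have "m \<ge> int 2 \<or> m \<le> - 1 - int 2" using that by simp arith
        from half_int_square_ge [OF this] show ?thesis by (simp add: power2_eq_square)
      qed
      thus ?thesis using C(2) [OF L, of V "-?F"] by (simp add: R_def V_def)
    qed
    have "of_real (qpoch_inf q q) = of_real (sqrt L) * ((?g 0 + ?g (- 1 - 0)) + (?g 1 + ?g (- 1 - 1)) + R)"
      unfolding Q R_def using theta_transformation [of L V] infsum_gauss_split [of L ?F V] L
      by (simp add: algebra_simps)
    \<comment> \<open>Since \<open>L * v = - 1/6\<close>, this pair has the cosine of
      \<open>pi / 6\<close>, whence \<open>sqrt 3\<close>; it combines with \<open>sqrt L\<close> to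
      \<open>sqrt (2 * l)\<close>.\<close>
    also have "?g 0 + ?g (- 1 - 0) = of_real (sqrt 3 * exp (pi * L * (v\<^sup>2 - 1/4)))"
    proof -
      have "pi * L * v * (2 * of_int 0 + 1) = - (pi / 6)" using Lv by (simp add: mult.assoc)
      thus ?thesis unfolding V_def gauss_term_pair by (simp add: cos_30 power2_eq_square)
    qed
    also have "?g 1 + ?g (- 1 - 1) = 0"
    proof -
      have "pi * L * v * (2 * of_int 1 + 1) = - (pi / 2)" using Lv by (simp add: mult.assoc)
      thus ?thesis unfolding V_def gauss_term_pair by simp
    qed
    finally have Q': "of_real (qpoch_inf q q) =
        of_real (sqrt L) * (of_real (sqrt 3 * exp (pi * L * (v\<^sup>2 - 1/4))) + R)" by simp
    define M where "M = sqrt (2 * l) * exp (pi / (24 * l) - pi * l / 6)"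
    have M0: "M > 0" using l by (simp add: M_def)
    have e1: "pi * L * (v\<^sup>2 - 1/4) = pi / (24 * l) - pi * l / 6"
      using l by (simp add: L_def v_def power2_eq_square field_simps)
    have s: "sqrt L * sqrt 3 = sqrt (2 * l)"
      unfolding L_def real_sqrt_mult [symmetric] by simp
    have M1: "sqrt L * (sqrt 3 * exp (pi * L * (v\<^sup>2 - 1/4))) = M"
      unfolding M_def e1 by (simp flip: s)
    have Q'': "of_real (qpoch_inf q q - M) = of_real (sqrt L) * R"
      using Q' unfolding M1 [symmetric] by (simp add: algebra_simps)
    have "\<bar>qpoch_inf q q - M\<bar> = norm (of_real (qpoch_inf q q - M) :: complex)" by (simp only: norm_of_real)
    also have "\<dots> \<le> sqrt L * (C * exp (pi * L * (v\<^sup>2 - 25/4)))"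
      unfolding Q'' using R L by (simp add: norm_mult mult_left_mono)
    also have "\<dots> \<le> sqrt L * (C * (sqrt 3 * exp (pi * L * (v\<^sup>2 - 25/4))))"
      using C(1) L by (intro mult_left_mono) (auto simp: real_le_rsqrt)
    also have "exp (pi * L * (v\<^sup>2 - 25/4)) = exp (pi * L * (v\<^sup>2 - 1/4)) * exp (- 4 * pi * l)"
      unfolding exp_add [symmetric] by (simp add: L_def algebra_simps)
    also have "sqrt L * (C * (sqrt 3 * (exp (pi * L * (v\<^sup>2 - 1/4)) * exp (- 4 * pi * l)))) = C * exp (- 4 * pi * l) * M"
      unfolding M1 [symmetric] by (simp add: algebra_simps)
    finally have "\<bar>qpoch_inf q q - M\<bar> \<le> C * exp (- 4 * pi * l) * M" .
    moreover have "\<bar>qpoch_inf q q / M - 1\<bar> = \<bar>qpoch_inf q q - M\<bar> / M"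
    proof -
      have "qpoch_inf q q / M - 1 = (qpoch_inf q q - M) / M" using M0 by (simp add: field_simps)
      thus ?thesis using M0 by (simp add: abs_divide)
    qed
    ultimately have "\<bar>qpoch_inf q q / M - 1\<bar> \<le> C * exp (- 4 * pi * l)"
      using M0 by (simp add: divide_le_eq)
    thus "\<bar>qpoch_inf (exp (- pi / l)) (exp (- pi / l)) / (sqrt (2 * l) * exp (pi / (24 * l) - pi * l / 6)) - 1\<bar> \<le> C * exp (- 4 * pi * l)"
      by (simp only: q_def M_def)
  qed
qed

subsection \<open>The \<open>q\<close>-Bessel function\<close>

text \<open>What remains of the coefficient once \<open>1 / (q; q)_\<infinity>^2\<close> is
  extracted: in \<open>1 / ((q; q)_k (q^(\<nu> + 1); q)_k)\<close> the tails of the infinite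
  products move to the numerator, and the numerator of the prefactor of the Bessel function cancels.
  The weights tend to 1 as \<open>k\<close> grows.\<close>

definition bessel_weight :: "real \<Rightarrow> real \<Rightarrow> nat \<Rightarrow> real" where
  "bessel_weight \<nu> q k = qpoch_inf (q * q ^ k) q * qpoch_inf (q powr (\<nu> + 1) * q ^ k) q"

text \<open>For \<open>X\<close> and \<open>Y\<close> in the unit interval,
  \<open>1 - X * Y \<le> (1 - X) + (1 - Y)\<close>. Both base points are at most
  \<open>q ^ k\<close>, the second because \<open>\<nu> + 1 > 0\<close>, so the product bound
  applies to each factor.\<close>

lemma bessel_weight_bounds:
  assumes "0 < q" "q < 1" "\<nu> > -1"
  shows "0 \<le> bessel_weight \<nu> q k" "bessel_weight \<nu> q k \<le> 1" "1 - 2 * q ^ k / (1 - q) \<le> bessel_weight \<nu> q k"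
proof -
  let ?x = "q * q ^ k" and ?y = "q powr (\<nu> + 1) * q ^ k"
  have qk: "0 \<le> q ^ k" "q ^ k \<le> 1" using assms by (auto intro: power_le_one)
  have "q powr (\<nu> + 1) \<le> q powr 0" using assms by (intro powr_mono') auto
  hence x: "0 \<le> ?x" "?x \<le> q ^ k" and y: "0 \<le> ?y" "?y \<le> q ^ k"
    using assms qk by (auto intro!: mult_left_le_one_le)
  note xb = qpoch_inf_bounds [OF assms(1,2) x(1) order_trans [OF x(2) qk(2)]]
  note yb = qpoch_inf_bounds [OF assms(1,2) y(1) order_trans [OF y(2) qk(2)]]
  show "0 \<le> bessel_weight \<nu> q k" "bessel_weight \<nu> q k \<le> 1"
    unfolding bessel_weight_def using xb yb by (auto intro: mult_le_one)
  have "?x / (1 - q) \<le> q ^ k / (1 - q)" "?y / (1 - q) \<le> q ^ k / (1 - q)"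
    using x y assms by (auto intro!: divide_right_mono)
  hence "(1 - qpoch_inf ?x q) + (1 - qpoch_inf ?y q) \<le> 2 * q ^ k / (1 - q)"
    using xb(1) yb(1) by simp
  moreover have "0 \<le> (1 - qpoch_inf ?x q) * (1 - qpoch_inf ?y q)"
    using xb yb by simp
  ultimately show "1 - 2 * q ^ k / (1 - q) \<le> bessel_weight \<nu> q k"
    unfolding bessel_weight_def by (simp add: algebra_simps)
qed

text \<open>Setting the weights to \<open>0\<close> at negative \<open>k\<close>, their distance from \<open>1\<close> is at most
  \<open>2 * q ^ k / (1 - q)\<close> for every integer \<open>k\<close>, so the error is again bounded by a theta series.\<close>

lemma weighted_theta_approx:
  fixes V :: complex
  assumes l: "l > 0" and nu: "\<nu> > -1"
  defines "q \<equiv> exp (- pi / l)"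
  shows "(\<lambda>k. norm (of_real (bessel_weight \<nu> q k) * theta_term l V (int k - 2 * int n))) summable_on UNIV" (is ?A)
    and "norm ((\<Sum>\<^sub>\<infinity>k. of_real (bessel_weight \<nu> q k) * theta_term l V (int k - 2 * int n)) - (\<Sum>\<^sub>\<infinity>j. theta_term l V j))
      \<le> 2 * exp (- 2 * pi * real n / l) / (1 - q) * norm (\<Sum>\<^sub>\<infinity>j. theta_term l (Re V - 1 / (2 * l)) j)" (is ?B)
proof -
  have q: "0 < q" "q < 1" using l by (auto simp: q_def)
  note bd = bessel_weight_bounds [OF q nu]
  let ?u = "bessel_weight \<nu> q" and ?t = "theta_term l V"
  define s where "s k = int k - 2 * int n" for k
  have inj: "inj s" by (auto simp: inj_on_def s_def)
  have "(\<lambda>k. norm (?t (s k))) summable_on UNIV"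
    using abs_summable_theta_term [OF l, of V "range s"] summable_on_reindex [OF inj, of "\<lambda>j. norm (?t j)"]
    by (simp add: o_def)
  thus ?A
    unfolding s_def [symmetric]
    by (rule summable_on_comparison_test)
       (use bd(1,2) in \<open>auto simp: norm_mult intro: mult_left_le_one_le\<close>)
  define U where "U j = (if j \<in> range s then ?u (nat (j + 2 * int n)) else 0)" for j
  have rs: "j \<in> range s \<longleftrightarrow> j \<ge> - 2 * int n" for j
  proof
    assume "j \<ge> - 2 * int n"
    hence "j = s (nat (j + 2 * int n))" by (simp add: s_def)
    thus "j \<in> range s" by blast
  qed (auto simp: s_def)
  have U01: "0 \<le> U j" "U j \<le> 1" for j
    using bd(1,2) by (auto simp: U_def)
  let ?K = "2 * exp (- 2 * pi * real n / l) / (1 - q)"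
  have K0: "?K \<ge> 0" using q by auto
  \<comment> \<open>With \<open>k = j + 2 * n\<close>, \<open>q ^ k\<close> splits into
    \<open>exp (- 2 * pi * n / l)\<close>, kept in \<open>?K\<close>, and
    \<open>exp (- pi * j / l)\<close>, which later shifts the theta argument by
    \<open>- 1 / (2 * l)\<close>. For negative \<open>k\<close> the weight is 0 and the bound holds
    because the right-hand side exceeds 1.\<close>
  have U: "1 - U j \<le> ?K * exp (- pi / l * of_int j)" for j
  proof -
    have e: "?K * exp (- pi / l * of_int j) = 2 * exp (- pi / l * (of_int j + 2 * real n)) / (1 - q)"
      by (simp add: exp_add [symmetric] algebra_simps add_divide_distrib)
    show ?thesis
    proof (cases "j \<in> range s")
      case True
      hence j: "j \<ge> - 2 * int n" by (simp add: rs)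
      have "exp (- pi / l * (of_int j + 2 * real n)) = q ^ nat (j + 2 * int n)"
        unfolding q_def exp_of_nat_mult [symmetric] using j by simp
      thus ?thesis unfolding e using bd(3) [of "nat (j + 2 * int n)"] True by (simp add: U_def)
    next
      case False
      hence j: "of_int j + 2 * real n \<le> 0" unfolding rs by linarith
      have "1 - U j \<le> 1" using U01 by simp
      also have "1 \<le> 2 * exp (- pi / l * (of_int j + 2 * real n))"
      proof -
        have "0 \<le> - pi / l * (of_int j + 2 * real n)"
          using j l by (intro mult_nonpos_nonpos) auto
        hence "1 \<le> exp (- pi / l * (of_int j + 2 * real n))" by simp
        thus ?thesis by linarith
      qed
      also have "\<dots> \<le> 2 * exp (- pi / l * (of_int j + 2 * real n)) / (1 - q)"
        using q by (simp add: divide_simps mult_left_le)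
      finally show ?thesis unfolding e .
    qed
  qed
  have sumt: "?t summable_on A" for A using l by (rule summable_theta_term)
  have "(\<lambda>j. of_real (U j) * ?t j) summable_on UNIV"
  proof (rule abs_summable_summable, rule summable_on_comparison_test [OF abs_summable_theta_term [OF l, of V UNIV]])
    show "norm (of_real (U j) * ?t j) \<le> norm (?t j)" for j
      using U01 [of j] by (auto simp: norm_mult intro: mult_left_le_one_le)
  qed auto
  note sumU = this
  have sumD: "(\<lambda>j. of_real (U j) * ?t j - ?t j) summable_on UNIV"
    using summable_on_add [OF sumU summable_on_uminus [THEN iffD2, OF sumt]] by simp
  have "(\<Sum>\<^sub>\<infinity>k. of_real (?u k) * ?t (s k)) = (\<Sum>\<^sub>\<infinity>j\<in>range s. of_real (U j) * ?t j)"
    by (subst infsum_reindex [OF inj]) (auto simp: o_def U_def s_def)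
  also have "\<dots> = (\<Sum>\<^sub>\<infinity>j. of_real (U j) * ?t j)"
    by (rule infsum_cong_neutral) (auto simp: U_def)
  finally have "(\<Sum>\<^sub>\<infinity>k. of_real (?u k) * ?t (s k)) - (\<Sum>\<^sub>\<infinity>j. ?t j) = (\<Sum>\<^sub>\<infinity>j. of_real (U j) * ?t j - ?t j)"
    using infsum_add [OF sumU summable_on_uminus [THEN iffD2, OF sumt]] by (simp add: infsum_uminus)
  also have "norm \<dots> \<le> (\<Sum>\<^sub>\<infinity>j. ?K * norm (theta_term l (Re V - 1 / (2 * l)) j))"
  proof (rule norm_infsum_le)
    show "((\<lambda>j. of_real (U j) * ?t j - ?t j) has_sum (\<Sum>\<^sub>\<infinity>j. of_real (U j) * ?t j - ?t j)) UNIV"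
      by (rule has_sum_infsum [OF sumD])
    show "((\<lambda>j. ?K * norm (theta_term l (Re V - 1 / (2 * l)) j)) has_sum
            (\<Sum>\<^sub>\<infinity>j. ?K * norm (theta_term l (Re V - 1 / (2 * l)) j))) UNIV"
      by (intro has_sum_infsum summable_on_cmult_right abs_summable_theta_term l)
    fix j :: int
    have "norm (theta_term l (Re V - 1 / (2 * l)) j) = exp (- pi / l * of_int j) * norm (?t j)"
      unfolding theta_term_def norm_exp_eq_Re exp_add [symmetric]
      by (intro arg_cong [where f = exp]) (simp add: algebra_simps)
    moreover have "norm (of_real (U j) * ?t j - ?t j) = (1 - U j) * norm (?t j)"
    proof -
      have "of_real (U j) * ?t j - ?t j = of_real (- (1 - U j)) * ?t j" by (simp add: algebra_simps)
      thus ?thesis using U01 [of j] by (simp only: norm_mult norm_of_real abs_minus_cancel)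
    qed
    ultimately show "norm (of_real (U j) * ?t j - ?t j) \<le> ?K * norm (theta_term l (Re V - 1 / (2 * l)) j)"
      using mult_right_mono [OF U [of j] norm_ge_zero [of "?t j"]] by (simp add: mult.assoc)
  qed
  also have "\<dots> = ?K * (\<Sum>\<^sub>\<infinity>j. norm (theta_term l (Re V - 1 / (2 * l)) j))"
    by (rule infsum_cmult_right')
  \<comment> \<open>At a real argument all theta terms are positive, so the sum of norms is itself a
    theta series, to which the asymptotics apply.\<close>
  also have "(\<Sum>\<^sub>\<infinity>j. norm (theta_term l (Re V - 1 / (2 * l)) j)) = norm (\<Sum>\<^sub>\<infinity>j. theta_term l (Re V - 1 / (2 * l)) j)"
  proof -
    have t: "theta_term l (of_real x) j = of_real (norm (theta_term l (of_real x) j))" for x j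
      by (simp add: theta_term_def exp_of_real [symmetric])
    have "(\<Sum>\<^sub>\<infinity>j. theta_term l (of_real x) j) = of_real (\<Sum>\<^sub>\<infinity>j. norm (theta_term l (of_real x) j))" for x
      by (subst t) (intro infsumI has_sum_of_real has_sum_infsum abs_summable_theta_term l)
    from this [of "Re V - 1 / (2 * l)"] show ?thesis
      by (simp add: infsum_nonneg)
  qed
  finally show ?B by (simp only: s_def)
qed

text \<open>The hypothesis on \<open>\<epsilon>\<close> and \<open>V\<close> records how signs
  combine: for \<open>\<epsilon> = \<i>\<close> the factor \<open>\<epsilon> ^ (2 * k)\<close>
  cancels \<open>(-1) ^ k\<close>; for \<open>\<epsilon> = 1\<close> the sign survives, equals
  \<open>(-1) powi (k - 2 * n)\<close> because the shift is even, and is encoded by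
  \<open>\<i> / 2\<close>.\<close>

lemma jackson_J2_eq_theta:
  fixes l \<nu> v :: real and n :: nat and \<epsilon> V :: complex
  assumes l: "l > 0" and nu: "\<nu> > -1"
    and eps: "\<epsilon> = 1 \<and> V = of_real v + \<i> / 2 \<or> \<epsilon> = \<i> \<and> V = of_real v"
  defines "q \<equiv> exp (- pi / l)"
  shows "jackson_J2 \<nu> (2 * \<epsilon> * of_real (sqrt (exp (2 * pi * v) * q powr (-\<nu>))) * of_real (q powi (- 2 * int n))) q =
    of_real (exp (4 * pi * v * n + 4 * pi * n\<^sup>2 / l + \<nu> * (pi * v + pi * \<nu> / (2 * l) + 2 * pi * n / l)) / (qpoch_inf q q)\<^sup>2)
     * \<epsilon> powr \<nu> * (\<Sum>\<^sub>\<infinity>k. of_real (bessel_weight \<nu> q k) * theta_term l V (int k - 2 * int n))"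
proof -
  have q: "0 < q" "q < 1" using l by (auto simp: q_def)
  define L where "L = pi * v + pi * \<nu> / (2 * l) + 2 * pi * n / l"
  have r: "sqrt (exp (2 * pi * v) * q powr (-\<nu>)) * q powi (- 2 * int n) = exp L"
  proof -
    have "exp (2 * pi * v) * q powr (-\<nu>) = (exp (pi * v + pi * \<nu> / (2 * l)))\<^sup>2"
      unfolding q_def powr_def exp_double [symmetric] by (simp add: exp_add [symmetric] field_simps)
    hence "sqrt (exp (2 * pi * v) * q powr (-\<nu>)) = exp (pi * v + pi * \<nu> / (2 * l))" by simp
    moreover have "q powi (- 2 * int n) = exp (2 * pi * n / l)"
      unfolding q_def exp_power_int by (simp add: field_simps)
    ultimately show ?thesis by (simp add: L_def exp_add)
  qed
  define w where "w = 2 * \<epsilon> * of_real (sqrt (exp (2 * pi * v) * q powr (-\<nu>))) * of_real (q powi (- 2 * int n))"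
  have w: "w / 2 = \<epsilon> * of_real (exp L)"
    unfolding w_def r [symmetric] by simp
  have wpow: "(w / 2) powr of_real \<nu> = of_real (exp (\<nu> * L)) * \<epsilon> powr \<nu>"
  proof -
    \<comment> \<open>The logarithm is additive here because one factor is a positive real, so the
      principal branch is not crossed.\<close>
    have "Ln (\<epsilon> * of_real (exp L)) = Ln \<epsilon> + of_real L"
      proof -
      have "\<epsilon> \<noteq> 0" using eps by auto
      hence "Ln (of_real (exp L) * \<epsilon>) = of_real (ln (exp L)) + Ln \<epsilon>"
        by (subst Ln_times_of_real) (auto simp: Ln_of_real simp del: ln_exp)
      thus ?thesis by (simp only: ln_exp mult.commute add.commute)
    qed
    thus ?thesis unfolding w using eps
      by (auto simp: powr_def algebra_simps exp_add simp flip: exp_of_real)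
  qed
  let ?x = "q powr (\<nu> + 1)" and ?Q = "qpoch_inf q q"
  let ?u = "bessel_weight \<nu> q" and ?t = "\<lambda>k. theta_term l V (int k - 2 * int n)"
  have x: "0 < ?x" "?x < 1" 
  proof -
    have "?x = exp ((\<nu> + 1) * (- pi / l))" by (simp add: q_def powr_def)
    moreover have "(\<nu> + 1) * (- pi / l) < 0" using l nu by (intro mult_pos_neg) auto
    ultimately show "?x < 1" by simp
  qed (use q in simp)
  have pos: "?Q > 0" "qpoch_inf ?x q > 0" using q x by (auto intro: qpoch_inf_pos)
  have coeff: "qpoch_inf ?x q / ?Q * (1 / (qpoch q q k * qpoch ?x q k)) = ?u k / ?Q\<^sup>2" for k
    using pos by (simp add: qpoch_def bessel_weight_def field_simps power2_eq_square)
  \<comment> \<open>In \<open>2 * k * L\<close> the part of \<open>L\<close> containing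
    \<open>\<nu>\<close> cancels \<open>q powr (k * \<nu>)\<close>. Then
    \<open>4 * n * k - k\<^sup>2 = 4 * n\<^sup>2 - (k - 2 * n)\<^sup>2\<close> completes the square,
    and \<open>A\<close> is the part independent of \<open>k\<close>.\<close>
  define A where "A = 4 * pi * v * n + 4 * pi * n\<^sup>2 / l"
  have term_eq: "of_real (q powr ((real k)\<^sup>2 + real k * \<nu>) * (-1) ^ k) * (w / 2) ^ (2 * k) = of_real (exp A) * ?t k" for k
  proof -
    let ?X = "exp (2 * pi * v * of_int (int k - 2 * int n) - pi / l * (of_int (int k - 2 * int n))\<^sup>2)"
    have "(-1) ^ k * \<epsilon> ^ (2 * k) * of_real ?X = ?t k"
    proof (cases "\<epsilon> = 1")
      case True
      hence V: "V = of_real v + \<i> / 2" using eps by auto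
      have "(-1::complex) powi (int k - 2 * int n) = (-1) ^ k"
        by (simp add: power_int_diff power_int_mult)
      thus ?thesis unfolding V theta_term_half using True by (simp add: theta_term_def mult_ac flip: exp_of_real)
    next
      case False
      hence V: "V = of_real v" "\<epsilon> = \<i>" using eps by auto
      have "(-1) ^ k * \<i> ^ (2 * k) = (1::complex)"
        by (simp add: power_mult flip: power_mult_distrib)
      thus ?thesis unfolding V by (simp add: theta_term_def mult_ac flip: exp_of_real)
    qed
    moreover have "q powr ((real k)\<^sup>2 + real k * \<nu>) * exp L ^ (2 * k) =
        exp A * ?X"
      unfolding exp_of_nat_mult [symmetric] powr_def q_def A_def L_def using l
      by (simp add: exp_add [symmetric]) (simp add: field_simps power2_eq_square)
    ultimately have t: "(-1) ^ k * \<epsilon> ^ (2 * k) * of_real ?X = ?t k"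
      and p: "q powr ((real k)\<^sup>2 + real k * \<nu>) * exp L ^ (2 * k) = exp A * ?X" by simp_all
    have "of_real (q powr ((real k)\<^sup>2 + real k * \<nu>) * (-1) ^ k) * (w / 2) ^ (2 * k) =
        (-1) ^ k * \<epsilon> ^ (2 * k) * of_real (q powr ((real k)\<^sup>2 + real k * \<nu>) * exp L ^ (2 * k))"
      unfolding w power_mult_distrib by simp
    also have "\<dots> = of_real (exp A) * ((-1) ^ k * \<epsilon> ^ (2 * k) * of_real ?X)"
      unfolding p by simp
    finally show ?thesis unfolding t .
  qed
  have sum: "(\<lambda>k. of_real (?u k) * ?t k) summable_on UNIV"
    using weighted_theta_approx(1) [OF l nu, of V n] unfolding q_def by (rule abs_summable_summable)
  let ?c = "of_real (exp (\<nu> * L)) * \<epsilon> powr \<nu> * of_real (exp A)"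
  have "jackson_J2 \<nu> w q = of_real (qpoch_inf ?x q / ?Q) * (\<Sum>k. of_real (?Q / qpoch_inf ?x q / ?Q\<^sup>2) * ?c * (of_real (?u k) * ?t k))"
    unfolding jackson_J2_def
  proof (rule arg_cong2 [where f = "(*)", OF refl suminf_cong])
    fix k
    have "of_real (q powr ((real k)\<^sup>2 + real k * \<nu>) * (-1) ^ k / (qpoch q q k * qpoch ?x q k)) * ((w / 2) ^ (2 * k) * (w / 2) powr of_real \<nu>)
       = of_real (1 / (qpoch q q k * qpoch ?x q k)) * (of_real (q powr ((real k)\<^sup>2 + real k * \<nu>) * (-1) ^ k) * (w / 2) ^ (2 * k)) * (w / 2) powr of_real \<nu>"
      by simp
    also have "1 / (qpoch q q k * qpoch ?x q k) = ?Q / qpoch_inf ?x q / ?Q\<^sup>2 * ?u k"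
      using coeff [of k] pos by (simp add: field_simps power2_eq_square)
    finally show "of_real (q powr ((real k)\<^sup>2 + real k * \<nu>) * (-1) ^ k / (qpoch q q k * qpoch ?x q k)) * ((w / 2) ^ (2 * k) * (w / 2) powr of_real \<nu>)
       = of_real (?Q / qpoch_inf ?x q / ?Q\<^sup>2) * ?c * (of_real (?u k) * ?t k)"
      unfolding term_eq wpow by simp
  qed
  also have "\<dots> = of_real (qpoch_inf ?x q / ?Q) * (of_real (?Q / qpoch_inf ?x q / ?Q\<^sup>2) * ?c * (\<Sum>\<^sub>\<infinity>k. of_real (?u k) * ?t k))"
    by (intro arg_cong2 [where f = "(*)", OF refl] sums_unique [symmetric] sums_mult
          has_sum_imp_sums [OF has_sum_infsum [OF sum]])
  also have "\<dots> = of_real (1 / ?Q\<^sup>2) * ?c * (\<Sum>\<^sub>\<infinity>k. of_real (?u k) * ?t k)"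
    using pos by simp
  also have "of_real (1 / ?Q\<^sup>2) * ?c = of_real (exp (A + \<nu> * L) / ?Q\<^sup>2) * \<epsilon> powr \<nu>"
    by (simp add: exp_add)
  finally show ?thesis unfolding w_def A_def L_def by simp
qed

text \<open>The rate 5 is 6 minus 1: \<open>n \<ge> 3 * l\<^sup>2\<close> makes
  \<open>exp (- 2 * pi * n / l)\<close> at most \<open>exp (- 6 * pi * l)\<close>, and
  \<open>1 / (1 - q) \<le> 2 * l \<le> 2 * exp (pi * l)\<close> costs one. Shifting the argument by
  \<open>1 / (2 * l)\<close> costs \<open>exp (pi * B + pi / 4)\<close>; this is where boundedness
  of \<open>Re V\<close> enters.\<close>

lemma weighted_theta_error:
  assumes nu: "\<nu> > -1" and B: "B \<ge> 0"
  obtains C where "C \<ge> 0" "\<And>l n V. l \<ge> 1 \<Longrightarrow> real n \<ge> 3 * l\<^sup>2 \<Longrightarrow> \<bar>Re V\<bar> \<le> B \<Longrightarrow>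
    norm ((\<Sum>\<^sub>\<infinity>k. of_real (bessel_weight \<nu> (exp (- pi / l)) k) * theta_term l V (int k - 2 * int n)) - (\<Sum>\<^sub>\<infinity>j. theta_term l V j))
      \<le> C * (sqrt l * exp (pi * l * (Re V)\<^sup>2)) * exp (- 5 * pi * l)"
proof -
  obtain C where C: "C \<ge> 0" "\<And>l v::real. l \<ge> 1 \<Longrightarrow>
     norm ((\<Sum>\<^sub>\<infinity>j. theta_term l v j) - of_real (sqrt l * exp (pi * l * v\<^sup>2)))
       \<le> C * (sqrt l * exp (pi * l * v\<^sup>2)) * exp (- pi * l)"
    by (rule infsum_theta_term_approx) blast
  show thesis
  proof (rule that)
    show "4 * (C + 1) * exp (pi * B + pi / 4) \<ge> 0" using C by simp
    fix l :: real and n :: nat and V :: complex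
    assume l: "l \<ge> 1" and n: "real n \<ge> 3 * l\<^sup>2" and V: "\<bar>Re V\<bar> \<le> B"
    define q where "q = exp (- pi / l)"
    define v where "v = Re V"
    define v' where "v' = v - 1 / (2 * l)"
    let ?g = "sqrt l * exp (pi * l * v'\<^sup>2)"
    have "norm (\<Sum>\<^sub>\<infinity>j. theta_term l v' j) \<le> norm (of_real ?g :: complex) + C * ?g * exp (- pi * l)"
      using C(2) [OF l, of v'] norm_triangle_sub [of "\<Sum>\<^sub>\<infinity>j. theta_term l v' j" "of_real ?g"] by linarith
    also have "\<dots> \<le> ?g + C * ?g * 1"
      using C(1) l by (intro add_mono mult_left_mono) (auto simp: norm_mult)
    also have "\<dots> = (C + 1) * ?g" by (simp add: algebra_simps)
    also have "\<dots> \<le> (C + 1) * (sqrt l * (exp (pi * l * v\<^sup>2) * exp (pi * B + pi / 4)))"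
    proof -
      have "pi * l * v'\<^sup>2 = pi * l * v\<^sup>2 + pi * (- v) + pi / 4 * (1 / l)"
        using l by (simp add: v'_def power2_eq_square field_simps)
      also have "\<dots> \<le> pi * l * v\<^sup>2 + pi * B + pi / 4 * 1"
        using V l by (intro add_mono mult_left_mono order_refl) (auto simp: v_def)
      finally have "exp (pi * l * v'\<^sup>2) \<le> exp (pi * l * v\<^sup>2) * exp (pi * B + pi / 4)"
        unfolding exp_add [symmetric] by simp
      thus ?thesis using C(1) l by (intro mult_left_mono) auto
    qed
    finally have th: "norm (\<Sum>\<^sub>\<infinity>j. theta_term l v' j) \<le> (C + 1) * (sqrt l * (exp (pi * l * v\<^sup>2) * exp (pi * B + pi / 4)))" .
    have q1: "1 / (1 - q) \<le> 2 * l"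
    proof -
      have "q * (1 + pi / l) \<le> q * exp (pi / l)"
        by (intro mult_left_mono exp_ge_add_one_self) (simp add: q_def)
      also have "\<dots> = 1" by (simp add: q_def flip: exp_add)
      finally have "1 / (1 - q) \<le> (1 + pi / l) / (pi / l)"
        using l by (simp add: q_def divide_simps) (simp add: algebra_simps)
      also have "\<dots> = l / pi + 1" using l by (simp add: field_simps)
      also have "\<dots> \<le> l + l" using l pi_ge_two by (intro add_mono) (auto simp: divide_le_eq mult_le_cancel_left1)
      finally show ?thesis by simp
    qed
    have e1: "exp (- 2 * pi * real n / l) \<le> exp (- 6 * pi * l)"
    proof -
      have "6 * l * l \<le> 2 * real n" using n by (simp add: power2_eq_square)
      hence "pi * (6 * l) \<le> pi * (2 * real n / l)"
        using l by (intro mult_left_mono) (auto simp: field_simps)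
      thus ?thesis by (simp add: algebra_simps)
    qed
    have e2: "l \<le> exp (pi * l)"
    proof -
      have "1 * l \<le> pi * l" using l pi_ge_two by (intro mult_right_mono) auto
      also have "\<dots> \<le> exp (pi * l)" using exp_ge_add_one_self [of "pi * l"] by linarith
      finally show ?thesis by simp
    qed
    have "2 * exp (- 2 * pi * real n / l) / (1 - q) = 2 * exp (- 2 * pi * real n / l) * (1 / (1 - q))" by simp
    also have "\<dots> \<le> 2 * exp (- 6 * pi * l) * (2 * l)"
      using e1 q1 l by (intro mult_mono) (auto simp: q_def)
    also have "\<dots> \<le> 2 * exp (- 6 * pi * l) * (2 * exp (pi * l))"
      using e2 by (intro mult_left_mono) auto
    also have "\<dots> = 4 * exp (- 5 * pi * l)" by (simp add: exp_add [symmetric])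
    finally have K: "2 * exp (- 2 * pi * real n / l) / (1 - q) \<le> 4 * exp (- 5 * pi * l)" .
    have "norm ((\<Sum>\<^sub>\<infinity>k. of_real (bessel_weight \<nu> q k) * theta_term l V (int k - 2 * int n)) - (\<Sum>\<^sub>\<infinity>j. theta_term l V j))
        \<le> 2 * exp (- 2 * pi * real n / l) / (1 - q) * norm (\<Sum>\<^sub>\<infinity>j. theta_term l v' j)"
      using weighted_theta_approx(2) [OF _ nu, of l V n] l unfolding v'_def v_def q_def by simp
    also have "\<dots> \<le> 4 * exp (- 5 * pi * l) * ((C + 1) * (sqrt l * (exp (pi * l * v\<^sup>2) * exp (pi * B + pi / 4))))"
      by (intro mult_mono K th) auto
    finally show "norm ((\<Sum>\<^sub>\<infinity>k. of_real (bessel_weight \<nu> (exp (- pi / l)) k) * theta_term l V (int k - 2 * int n)) - (\<Sum>\<^sub>\<infinity>j. theta_term l V j))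
      \<le> 4 * (C + 1) * exp (pi * B + pi / 4) * (sqrt l * exp (pi * l * (Re V)\<^sup>2)) * exp (- 5 * pi * l)"
      by (simp add: q_def v_def algebra_simps)
  qed
qed

text \<open>The squared leading term of \<open>(q; q)_\<infinity>\<close>, with
  \<open>q = exp (- pi / l)\<close>, divided by the exact square; it carries the whole error of the
  prefactor.\<close>

definition euler_ratio :: "real \<Rightarrow> real" where
  "euler_ratio l = 2 * l * exp (pi / (12 * l) - pi * l / 3) / (qpoch_inf (exp (- pi / l)) (exp (- pi / l)))\<^sup>2"

lemma euler_ratio_approx:
  obtains C R where "C \<ge> 0" "\<And>l. l \<ge> R \<Longrightarrow> \<bar>euler_ratio l - 1\<bar> \<le> C * exp (- 4 * pi * l)" "\<And>l. l \<ge> R \<Longrightarrow> \<bar>euler_ratio l\<bar> \<le> 4"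
proof -
  obtain C where C: "C \<ge> 0" "\<And>l. l \<ge> 3 / 2 \<Longrightarrow>
     \<bar>qpoch_inf (exp (- pi / l)) (exp (- pi / l)) / (sqrt (2 * l) * exp (pi / (24 * l) - pi * l / 6)) - 1\<bar> \<le> C * exp (- 4 * pi * l)"
    by (rule qpoch_inf_self_approx) blast
  show thesis
  proof (rule that)
    show "10 * C \<ge> 0" using C by simp
    fix l :: real
    \<comment> \<open>The threshold \<open>C\<close> gives
      \<open>2 * C \<le> 2 * l \<le> exp (4 * pi * l)\<close>, so \<open>y\<close> stays within
      \<open>1/2\<close> of 1. Then \<open>1 + y \<le> 5/2 \<le> 10 * y\<^sup>2\<close>, the source
      of the factor 10.\<close>
    assume l: "l \<ge> max (3 / 2) C"
    define y where "y = qpoch_inf (exp (- pi / l)) (exp (- pi / l)) / (sqrt (2 * l) * exp (pi / (24 * l) - pi * l / 6))"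
    have y: "\<bar>y - 1\<bar> \<le> C * exp (- 4 * pi * l)" using C(2) l unfolding y_def by simp
    have r: "euler_ratio l = 1 / y\<^sup>2"
    proof -
      have "(exp (pi / (24 * l) - pi * l / 6))\<^sup>2 = exp (pi / (12 * l) - pi * l / 3)"
        unfolding exp_double [symmetric] by (simp add: algebra_simps)
      moreover have "(sqrt (2 * l))\<^sup>2 = 2 * l" using l by simp
      ultimately show ?thesis unfolding euler_ratio_def y_def power_divide power_mult_distrib by simp
    qed
    have "C * exp (- 4 * pi * l) \<le> 1 / 2"
    proof -
      have "2 * l \<le> 4 * pi * l" using l pi_ge_two by (intro mult_right_mono) auto
      also have "\<dots> \<le> exp (4 * pi * l)" using exp_ge_add_one_self [of "4 * pi * l"] by linarith
      finally have "2 * C \<le> exp (4 * pi * l)" using l by linarith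
      thus ?thesis by (simp add: exp_minus field_simps)
    qed
    with y have y2: "1 / 2 \<le> y" "y \<le> 3 / 2" by linarith+
    have y4: "1 / 4 \<le> y\<^sup>2" using power_mono [OF y2(1), of 2] by (simp add: power2_eq_square)
    show "\<bar>euler_ratio l\<bar> \<le> 4" unfolding r using y4 y2 by (simp add: divide_simps)
    have "\<bar>1 / y\<^sup>2 - 1\<bar> = \<bar>y - 1\<bar> * ((1 + y) / y\<^sup>2)"
    proof -
      have "1 / y\<^sup>2 - 1 = - (y - 1) * ((1 + y) / y\<^sup>2)" using y2 by (simp add: field_simps power2_eq_square)
      thus ?thesis using y2 by (simp only: abs_mult abs_minus_cancel) simp
    qed
    also have "\<dots> \<le> (C * exp (- 4 * pi * l)) * 10"
    proof (rule mult_mono [OF y])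
      have "1 + y \<le> 10 * y\<^sup>2" using y4 y2 by linarith
      thus "(1 + y) / y\<^sup>2 \<le> 10" using y2 by (simp add: divide_le_eq)
    qed (use C y2 in auto)
    finally show "\<bar>euler_ratio l - 1\<bar> \<le> 10 * C * exp (- 4 * pi * l)" unfolding r by simp
  qed
qed

text \<open>Exponent of the exact prefactor plus that of the central Gaussian. Of
  \<open>\<nu>\<^sup>2 * pi / (2 * l)\<close> on the left, one half is absorbed by the square and
  the other half is the separate term of the expansions.\<close>

lemma bessel_exponent:
  fixes l v \<nu> :: real
  assumes "l > 0"
  shows "4 * pi * v * n + 4 * pi * n\<^sup>2 / l + \<nu> * (pi * v + pi * \<nu> / (2 * l) + 2 * pi * n / l) + pi * l * v\<^sup>2 =
    \<nu>\<^sup>2 * pi / (4 * l) + pi * l * (v + (4 * n + \<nu>) / (2 * l))\<^sup>2"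
  using assms by (simp add: field_simps power2_eq_square)

section \<open>Assembling the uniform expansions\<close>

lemma admissible_scale_eventually:
  assumes "admissible_scale lam"
  shows "\<forall>\<^sub>F n in sequentially. lam n \<ge> R \<and> real n \<ge> 3 * (lam n)\<^sup>2"
proof -
  have 1: "\<forall>\<^sub>F n in sequentially. lam n / ln (real n) \<ge> \<bar>R\<bar>" and 2: "\<forall>\<^sub>F n in sequentially. real n / (lam n)\<^sup>2 \<ge> 3"
    using assms unfolding admissible_scale_def by (auto simp: filterlim_at_top)
  show ?thesis
    using 1 2 eventually_ge_at_top [of 3]
  proof eventually_elim
    case (elim n)
    \<comment> \<open>From \<open>n = 3\<close> on the logarithm is at least 1, so a lower bound on
      the quotient passes to \<open>lam n\<close>; \<open>\<bar>R\<bar>\<close> replaces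
      \<open>R\<close> to keep the multiplication monotone.\<close>
    have "exp 1 \<le> real n" using elim(3) exp_le by linarith
    hence ln: "ln (real n) \<ge> 1" by (subst ln_ge_iff) (use elim in auto)
    have "R \<le> \<bar>R\<bar> * 1" by simp
    also have "\<dots> \<le> \<bar>R\<bar> * ln (real n)" using ln by (intro mult_left_mono) auto
    also have "\<dots> \<le> lam n" using elim(1) ln by (simp add: le_divide_eq)
    finally have "R \<le> lam n" .
    moreover have "lam n > 0" using assms elim(3) by (simp add: admissible_scale_def)
    ultimately show ?case using elim(2) by (simp add: le_divide_eq)
  qed
qed

lemma norm_mult_diff_le:
  fixes X m :: complex
  assumes "norm (X - m) \<le> a" "norm m \<le> 1" "\<bar>r - 1\<bar> \<le> b" "\<bar>r\<bar> \<le> 4"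
  shows "norm (X * of_real r - m) \<le> 4 * a + b"
proof -
  have "X * of_real r - m = (X - m) * of_real r + m * of_real (r - 1)" by (simp add: algebra_simps)
  also have "norm \<dots> \<le> norm (X - m) * \<bar>r\<bar> + norm m * \<bar>r - 1\<bar>"
    by (rule order_trans [OF norm_triangle_ineq]) (simp only: norm_mult norm_of_real order_refl)
  also have "\<dots> \<le> a * 4 + 1 * b"
    using assms order_trans [OF norm_ge_zero assms(1)] by (intro add_mono mult_mono) auto
  finally show ?thesis by simp
qed

text \<open>The two expansions are the cases \<open>(c, d, p) = (0, 1, 1)\<close> and \<open>(c, d, p) = (1/4, 2, 2)\<close>.\<close>

lemma normalized_bessel_bigo:
  fixes V :: "real \<Rightarrow> complex" and h :: "real \<Rightarrow> real" and m :: "real \<Rightarrow> real \<Rightarrow> real"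
  assumes adm: "admissible_scale lam" and nu: "\<nu> > -1"
    and V: "\<And>v. Re (V v) = v"
    and p: "p \<le> 4" and h: "0 \<le> c" "c + p \<le> 5" "d > 0" and m: "\<And>l v. \<bar>m l v\<bar> \<le> 1"
    and C: "C \<ge> 0" "\<And>l v. l \<ge> 1 \<Longrightarrow>
      norm ((\<Sum>\<^sub>\<infinity>j. theta_term l (V v) j) - of_real (d * sqrt l * exp (pi * l * (v\<^sup>2 - c)) * m l v))
       \<le> C * (d * sqrt l * exp (pi * l * (v\<^sup>2 - c))) * exp (- p * pi * l)"
  shows "bigo_unif_compact (\<lambda>n v. (\<Sum>\<^sub>\<infinity>k. of_real (bessel_weight \<nu> (exp (- pi / lam n)) k) * theta_term (lam n) (V v) (int k - 2 * int n))
      / of_real (d * sqrt (lam n) * exp (pi * lam n * (v\<^sup>2 - c))) * of_real (euler_ratio (lam n)) - of_real (m (lam n) v))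
     (\<lambda>n. exp (- p * pi * lam n))"
  unfolding bigo_unif_compact_def
proof (intro allI impI)
  fix K :: "real set"
  assume "compact K"
  then obtain B where B: "B > 0" "\<And>v. v \<in> K \<Longrightarrow> \<bar>v\<bar> \<le> B"
    using compact_imp_bounded bounded_pos by (metis real_norm_def)
  obtain C1 where C1: "C1 \<ge> 0" "\<And>l n V. l \<ge> 1 \<Longrightarrow> real n \<ge> 3 * l\<^sup>2 \<Longrightarrow> \<bar>Re V\<bar> \<le> B \<Longrightarrow>
    norm ((\<Sum>\<^sub>\<infinity>k. of_real (bessel_weight \<nu> (exp (- pi / l)) k) * theta_term l V (int k - 2 * int n)) - (\<Sum>\<^sub>\<infinity>j. theta_term l V j))
      \<le> C1 * (sqrt l * exp (pi * l * (Re V)\<^sup>2)) * exp (- 5 * pi * l)"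
    by (rule weighted_theta_error [OF nu, of B]) (use B in auto)
  obtain C2 R where C2: "C2 \<ge> 0" "\<And>l. l \<ge> R \<Longrightarrow> \<bar>euler_ratio l - 1\<bar> \<le> C2 * exp (- 4 * pi * l)"
     "\<And>l. l \<ge> R \<Longrightarrow> \<bar>euler_ratio l\<bar> \<le> 4"
    by (rule euler_ratio_approx) blast
  obtain N where N: "\<And>n. n \<ge> N \<Longrightarrow> lam n \<ge> max R 1 \<and> real n \<ge> 3 * (lam n)\<^sup>2"
    using admissible_scale_eventually [OF adm] unfolding eventually_sequentially by blast
  show "\<exists>C N. \<forall>n\<ge>N. \<forall>v\<in>K. norm ((\<Sum>\<^sub>\<infinity>k. of_real (bessel_weight \<nu> (exp (- pi / lam n)) k) * theta_term (lam n) (V v) (int k - 2 * int n))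
      / of_real (d * sqrt (lam n) * exp (pi * lam n * (v\<^sup>2 - c))) * of_real (euler_ratio (lam n)) - of_real (m (lam n) v))
        \<le> C * exp (- p * pi * lam n)"
  proof (intro exI [of _ "4 * (C1 / d + C) + C2"] exI [of _ N] allI impI ballI)
    fix n v
    assume "n \<ge> N" and v: "v \<in> K"
    define l where "l = lam n"
    from N [OF \<open>n \<ge> N\<close>] have l: "l \<ge> R" "l \<ge> 1" and n: "real n \<ge> 3 * l\<^sup>2" by (auto simp: l_def)
    define g where "g = d * sqrt l * exp (pi * l * (v\<^sup>2 - c))"
    have g: "g > 0" using l h by (simp add: g_def)
    define D where "D = (\<Sum>\<^sub>\<infinity>k. of_real (bessel_weight \<nu> (exp (- pi / l)) k) * theta_term l (V v) (int k - 2 * int n))"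
    define T where "T = (\<Sum>\<^sub>\<infinity>j. theta_term l (V v) j)"
    have "norm (D - T) \<le> C1 * (sqrt l * exp (pi * l * v\<^sup>2)) * exp (- 5 * pi * l)"
      using C1(2) [OF l(2) n, of "V v"] B(2) [OF v] unfolding V D_def T_def by simp
    \<comment> \<open>Measured against the amplitude \<open>g\<close> instead of the central
      Gaussian, the error loses \<open>exp (pi * l * c)\<close>; \<open>c + p \<le> 5\<close> says
      that the target rate \<open>p\<close> survives.\<close>
    also have "\<dots> = C1 / d * g * exp (pi * l * c + - 5 * pi * l)"
      using h unfolding g_def exp_add right_diff_distrib exp_diff by (simp add: field_simps)
    also have "\<dots> \<le> C1 / d * g * exp (- p * pi * l)"
    proof -
      have "pi * l * (c + p) \<le> pi * l * 5" using h l by (intro mult_left_mono) auto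
      hence "exp (pi * l * c + - 5 * pi * l) \<le> exp (- p * pi * l)" by (simp add: algebra_simps)
      thus ?thesis using C1(1) h g by (intro mult_left_mono) auto
    qed
    finally have 1: "norm (D - T) \<le> C1 / d * g * exp (- p * pi * l)" .
    have 2: "norm (T - of_real (g * m l v)) \<le> C * g * exp (- p * pi * l)"
      using C(2) [OF l(2), of v] unfolding T_def g_def by simp
    have "norm (D - of_real (g * m l v)) \<le> norm (D - T) + norm (T - of_real (g * m l v))"
      by norm
    also have "\<dots> \<le> (C1 / d + C) * exp (- p * pi * l) * g"
      using 1 2 by (simp add: algebra_simps)
    finally have 3: "norm (D - of_real (g * m l v)) \<le> (C1 / d + C) * exp (- p * pi * l) * g" .
    have "D / of_real g - of_real (m l v) = (D - of_real (g * m l v)) / of_real g"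
      using g by (simp add: field_simps)
    hence 4: "norm (D / of_real g - of_real (m l v)) \<le> (C1 / d + C) * exp (- p * pi * l)"
      using 3 g by (simp add: norm_divide divide_le_eq)
    have "\<bar>euler_ratio l - 1\<bar> \<le> C2 * exp (- 4 * pi * l)" by (rule C2(2) [OF l(1)])
    also have "\<dots> \<le> C2 * exp (- p * pi * l)"
      using C2(1) p l by (intro mult_left_mono) (auto intro!: mult_right_mono)
    finally have "norm (D / of_real g * of_real (euler_ratio l) - of_real (m l v)) \<le>
        4 * ((C1 / d + C) * exp (- p * pi * l)) + C2 * exp (- p * pi * l)"
      using norm_mult_diff_le [OF 4 _ _ C2(3) [OF l(1)]] m [of l v] by simp
    also have "\<dots> = (4 * (C1 / d + C) + C2) * exp (- p * pi * l)" by (simp add: algebra_simps)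
    finally show "norm ((\<Sum>\<^sub>\<infinity>k. of_real (bessel_weight \<nu> (exp (- pi / lam n)) k) * theta_term (lam n) (V v) (int k - 2 * int n))
      / of_real (d * sqrt (lam n) * exp (pi * lam n * (v\<^sup>2 - c))) * of_real (euler_ratio (lam n)) - of_real (m (lam n) v))
        \<le> (4 * (C1 / d + C) + C2) * exp (- p * pi * lam n)"
      unfolding D_def g_def l_def .
  qed
qed

theorem corollary4:
  fixes lam :: "nat \<Rightarrow> real" and \<nu> :: real
    and z :: "real \<Rightarrow> real" and q :: "nat \<Rightarrow> real"
  assumes "admissible_scale lam"
    and "\<nu> > -1"
    and "\<And>v. z v = exp (2 * pi * v)"
    and "\<And>n. q n = exp (- pi * inverse (lam n))"
  shows
    "(\<exists>E. bigo_unif_compact E (\<lambda>n. exp (- pi * lam n)) \<and>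
       (\<forall>n\<ge>1. \<forall>v.
          jackson_J2 \<nu> (2 * \<i> * of_real (sqrt (z v * q n powr (-\<nu>))) * of_real (q n powi (- 2 * int n))) (q n) =
            exp (of_real (pi * lam n / 3 - pi / (12 * lam n) + \<nu>\<^sup>2 * pi / (4 * lam n))
                 + of_real (\<nu> * pi / 2) * \<i>)
            / of_real (2 * sqrt (lam n))
            * of_real (exp (pi * lam n * (v + (4 * real n + \<nu>) / (2 * lam n))\<^sup>2))
            * (1 + E n v)))
     \<and>
     (\<exists>E. bigo_unif_compact E (\<lambda>n. exp (- 2 * pi * lam n)) \<and>
       (\<forall>n\<ge>1. \<forall>v.
          jackson_J2 \<nu> (2 * of_real (sqrt (z v * q n powr (-\<nu>))) * of_real (q n powi (- 2 * int n))) (q n) =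
            of_real (exp (pi * lam n / 12 - pi / (12 * lam n) + \<nu>\<^sup>2 * pi / (4 * lam n))
                     / sqrt (lam n))
            * of_real (exp (pi * lam n * (v + (4 * real n + \<nu>) / (2 * lam n))\<^sup>2))
            * (of_real (cos (pi * lam n * v)) + E n v)))"
proof -
  have q: "q n = exp (- pi / lam n)" for n
    by (simp add: assms(4) divide_inverse)
  define D where "D V n = (\<Sum>\<^sub>\<infinity>k. of_real (bessel_weight \<nu> (exp (- pi / lam n)) k) * theta_term (lam n) V (int k - 2 * int n))"
    for V :: complex and n
  define P where "P n v = 4 * pi * v * n + 4 * pi * n\<^sup>2 / lam n + \<nu> * (pi * v + pi * \<nu> / (2 * lam n) + 2 * pi * n / lam n)"
    for n :: nat and v :: real
  define b where "b n v = pi * lam n * (v + (4 * real n + \<nu>) / (2 * lam n))\<^sup>2" for n :: nat and v :: real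
  let ?a = "\<lambda>n. \<nu>\<^sup>2 * pi / (4 * lam n)"
  have P: "P n v = ?a n + b n v - pi * lam n * v\<^sup>2" if "lam n > 0" for n v
    using bessel_exponent [OF that, of v n \<nu>] unfolding P_def b_def by simp
  have Q: "1 / (qpoch_inf (q n) (q n))\<^sup>2 = euler_ratio (lam n) * exp (pi * lam n / 3 - pi / (12 * lam n)) / (2 * lam n)"
    if "lam n > 0" for n
  proof -
    have "exp (pi / (12 * lam n) - pi * lam n / 3) * exp (pi * lam n / 3 - pi / (12 * lam n)) = 1"
      by (simp flip: exp_add)
    thus ?thesis using that unfolding euler_ratio_def q by simp
  qed
  have pos: "lam n > 0" if "n \<ge> 1" for n
    using assms(1) that by (simp add: admissible_scale_def)

  obtain Ca where Ca: "Ca \<ge> 0" "\<And>l v::real. l \<ge> 1 \<Longrightarrow>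
     norm ((\<Sum>\<^sub>\<infinity>j. theta_term l v j) - of_real (sqrt l * exp (pi * l * v\<^sup>2)))
       \<le> Ca * (sqrt l * exp (pi * l * v\<^sup>2)) * exp (- pi * l)"
    by (rule infsum_theta_term_approx) blast
  obtain Cb where Cb: "Cb \<ge> 0" "\<And>l v::real. l \<ge> 1 \<Longrightarrow>
     norm ((\<Sum>\<^sub>\<infinity>j. theta_term l (v + \<i> / 2) j) - of_real (2 * sqrt l * exp (pi * l * (v\<^sup>2 - 1 / 4)) * cos (pi * l * v)))
       \<le> Cb * (2 * sqrt l * exp (pi * l * (v\<^sup>2 - 1 / 4))) * exp (- 2 * pi * l)"
    by (rule infsum_theta_term_half_approx) blast

  show ?thesis
  proof (intro conjI exI allI impI)
    \<comment> \<open>The witness for \<open>E\<close> is the normalized exact value minus the main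
      term, so the expansion is an identity for every \<open>n \<ge> 1\<close> and only this bound
      is asymptotic.\<close>
    show "bigo_unif_compact (\<lambda>n v. D v n / of_real (1 * sqrt (lam n) * exp (pi * lam n * (v\<^sup>2 - 0)))
             * of_real (euler_ratio (lam n)) - of_real 1) (\<lambda>n. exp (- pi * lam n))"
      using normalized_bessel_bigo [OF assms(1,2), of of_real 1 0 1 "\<lambda>_ _. 1" Ca] Ca
      unfolding D_def by simp
  next
    fix n :: nat and v :: real
    assume "n \<ge> 1"
    hence l: "lam n > 0" by (rule pos)
    have s: "sqrt (lam n) * sqrt (lam n) = lam n" using l by simp
    have i: "\<i> powr \<nu> = exp (of_real (\<nu> * pi / 2) * \<i>)"
      by (simp add: powr_def algebra_simps)
    have r: "exp (P n v) / (qpoch_inf (q n) (q n))\<^sup>2 =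
        exp (pi * lam n / 3 - pi / (12 * lam n) + ?a n) / (2 * sqrt (lam n)) * exp (b n v) * (1 / (sqrt (lam n) * exp (pi * lam n * v\<^sup>2)) * euler_ratio (lam n))"
    proof -
      have "exp (P n v) / (qpoch_inf (q n) (q n))\<^sup>2 = exp (P n v) * (1 / (qpoch_inf (q n) (q n))\<^sup>2)" by simp
      also have "\<dots> = (exp (P n v) * exp (pi * lam n / 3 - pi / (12 * lam n))) * euler_ratio (lam n) / (2 * lam n)"
        unfolding Q [OF l] by simp
      also have "exp (P n v) * exp (pi * lam n / 3 - pi / (12 * lam n)) =
          exp ((pi * lam n / 3 - pi / (12 * lam n) + ?a n) + b n v - pi * lam n * v\<^sup>2)"
        unfolding P [OF l] exp_add [symmetric] by (simp add: algebra_simps)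
      also have "\<dots> = exp (pi * lam n / 3 - pi / (12 * lam n) + ?a n) * exp (b n v) / exp (pi * lam n * v\<^sup>2)"
        by (simp only: exp_add exp_diff)
      also have "\<dots> * euler_ratio (lam n) / (2 * lam n) = \<dots> * euler_ratio (lam n) / (2 * (sqrt (lam n) * sqrt (lam n)))"
        by (simp only: s)
      finally show ?thesis by simp
    qed
    have "jackson_J2 \<nu> (2 * \<i> * of_real (sqrt (z v * q n powr (-\<nu>))) * of_real (q n powi (- 2 * int n))) (q n) =
        of_real (exp (P n v) / (qpoch_inf (q n) (q n))\<^sup>2) * \<i> powr \<nu> * D v n"
      using jackson_J2_eq_theta [OF l assms(2), of \<i> "of_real v" v n]
      unfolding P_def D_def q assms(3) by simp
    thus "jackson_J2 \<nu> (2 * \<i> * of_real (sqrt (z v * q n powr (-\<nu>))) * of_real (q n powi (- 2 * int n))) (q n) =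
            exp (of_real (pi * lam n / 3 - pi / (12 * lam n) + \<nu>\<^sup>2 * pi / (4 * lam n))
                 + of_real (\<nu> * pi / 2) * \<i>)
            / of_real (2 * sqrt (lam n))
            * of_real (exp (pi * lam n * (v + (4 * real n + \<nu>) / (2 * lam n))\<^sup>2))
            * (1 + (D v n / of_real (1 * sqrt (lam n) * exp (pi * lam n * (v\<^sup>2 - 0)))
             * of_real (euler_ratio (lam n)) - of_real 1))"
      unfolding r i b_def exp_add [of "of_real _" "_ * \<i>"] exp_of_real by simp
  next
    show "bigo_unif_compact (\<lambda>n v. D (v + \<i> / 2) n / of_real (2 * sqrt (lam n) * exp (pi * lam n * (v\<^sup>2 - 1/4)))
             * of_real (euler_ratio (lam n)) - of_real (cos (pi * lam n * v))) (\<lambda>n. exp (- 2 * pi * lam n))"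
      using normalized_bessel_bigo [OF assms(1,2), of "\<lambda>v. of_real v + \<i> / 2" 2 "1/4" 2 "\<lambda>l v. cos (pi * l * v)" Cb] Cb
      unfolding D_def by simp
  next
    fix n :: nat and v :: real
    assume "n \<ge> 1"
    hence l: "lam n > 0" by (rule pos)
    have s: "sqrt (lam n) * sqrt (lam n) = lam n" using l by simp
    \<comment> \<open>The \<open>1/4\<close> in the cosine amplitude lowers
      \<open>pi * lam n / 3\<close> to \<open>pi * lam n / 12\<close>, and its factor 2 cancels the
      2 in \<open>2 * lam n\<close>, so no 2 remains in the denominator.\<close>
    have r: "exp (P n v) / (qpoch_inf (q n) (q n))\<^sup>2 =
        exp (pi * lam n / 12 - pi / (12 * lam n) + ?a n) / sqrt (lam n) * exp (b n v) * (1 / (2 * sqrt (lam n) * exp (pi * lam n * (v\<^sup>2 - 1/4))) * euler_ratio (lam n))"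
    proof -
      have "exp (P n v) / (qpoch_inf (q n) (q n))\<^sup>2 = exp (P n v) * (1 / (qpoch_inf (q n) (q n))\<^sup>2)" by simp
      also have "\<dots> = (exp (P n v) * exp (pi * lam n / 3 - pi / (12 * lam n))) * euler_ratio (lam n) / (2 * lam n)"
        unfolding Q [OF l] by simp
      also have "exp (P n v) * exp (pi * lam n / 3 - pi / (12 * lam n)) =
          exp ((pi * lam n / 12 - pi / (12 * lam n) + ?a n) + b n v - pi * lam n * (v\<^sup>2 - 1/4))"
        unfolding P [OF l] exp_add [symmetric] by (simp add: algebra_simps)
      also have "\<dots> = exp (pi * lam n / 12 - pi / (12 * lam n) + ?a n) * exp (b n v) / exp (pi * lam n * (v\<^sup>2 - 1/4))"
        by (simp only: exp_add exp_diff)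
      also have "\<dots> * euler_ratio (lam n) / (2 * lam n) = \<dots> * euler_ratio (lam n) / (2 * (sqrt (lam n) * sqrt (lam n)))"
        by (simp only: s)
      finally show ?thesis by simp
    qed
    have "jackson_J2 \<nu> (2 * of_real (sqrt (z v * q n powr (-\<nu>))) * of_real (q n powi (- 2 * int n))) (q n) =
        of_real (exp (P n v) / (qpoch_inf (q n) (q n))\<^sup>2) * D (v + \<i> / 2) n"
      using jackson_J2_eq_theta [OF l assms(2), of 1 "of_real v + \<i> / 2" v n]
      unfolding P_def D_def q assms(3) by simp
    thus "jackson_J2 \<nu> (2 * of_real (sqrt (z v * q n powr (-\<nu>))) * of_real (q n powi (- 2 * int n))) (q n) =
            of_real (exp (pi * lam n / 12 - pi / (12 * lam n) + \<nu>\<^sup>2 * pi / (4 * lam n))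
                     / sqrt (lam n))
            * of_real (exp (pi * lam n * (v + (4 * real n + \<nu>) / (2 * lam n))\<^sup>2))
            * (of_real (cos (pi * lam n * v)) + (D (v + \<i> / 2) n / of_real (2 * sqrt (lam n) * exp (pi * lam n * (v\<^sup>2 - 1/4)))
             * of_real (euler_ratio (lam n)) - of_real (cos (pi * lam n * v))))"
      unfolding r b_def by simp
  qed
qed

end
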